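(* Let $N=4M^2$, with $M\geqslant 1$ a positive integer. Define $$r_j=4j,\qquad h_j=1-\frac{4j^2}{N},\qquad 1\leqslant j\leqslant M,$$ and consider the polynomial of degree $N$ given by $$P_N(z)=(z^{r_M}-1)\prod_{j=1}^{M-1}\left(z^{r_j}-\rho(h_j)^{r_j}\right)\left(z^{r_j}-\rho(h_j)^{-r_j}\right),$$ where $\rho(x)=\sqrt{\frac{1+x}{1-x}}$. Then $$\mu_{\text{norm}}(P_N)\leqslant \min\left(N,\tfrac{19}{2}\sqrt{N+1}\right).$$
   Context: For a homogeneous polynomial $h(x,y)=\sum_{i=0}^N a_ix^iy^{N-i}$ with $a_i\in\mathbb{C}$, $a_N\neq0$, $N\geqslant 1$, the Bombieri-Weyl norm is $\|h\|=\left(\sum_{i=0}^N\binom{N}{i}^{-1}|a_i|^2\right)^{1/2}$. The (Shub--Smale) normalized condition number of $h$ at a zero $\zeta\in\mathbb{P}(\mathbb{C}^2)$ is $$\mu_{\text{norm}}(h,\zeta)=N^{1/2}\left\|(Dh(\zeta)|_{\zeta^\perp})^{-1}\right\|\,\|h\|\,\|\zeta\|^{N-1}$$ if $Dh(\zeta)|_{\zeta^\perp}$ is invertible, and $+\infty$ otherwise, where $Dh(\zeta)|_{\zeta^\perp}$ is the restriction of the derivative $Dh(\zeta)$ to the orthogonal complement of $\zeta$ in $\mathbb{C}^2$. For a univariate polynomial $f(z)=\sum_{i=0}^N a_iz^i$ with $a_N\ne0$, with homogeneous counterpart $h(x,y)=\sum_{i=0}^N a_ix^iy^{N-i}$, one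 sets $\|f\|=\|h\|$, $\mu_{\text{norm}}(f,z)=\mu_{\text{norm}}(h,(z,1))$ for each zero $z\in\mathbb{C}$ of $f$, and $\mu_{\text{norm}}(f)=\max_{z\in\mathbb{C}:f(z)=0}\mu_{\text{norm}}(f,z)$. Equivalently, $$\mu_{\text{norm}}(f,z)=\frac{N^{1/2}(1+|z|^2)^{\frac{N-2}{2}}}{|f'(z)|}\|f\|$$ (equal to $+\infty$ if $f'(z)=0$). An empty product equals $1$. *)

theory Defs
  imports "HOL-Analysis.Analysis" "HOL-Computational_Algebra.Polynomial"
begin

(* A homogeneous polynomial of degree N in two variables is given by N and its coefficients
   a 0, ..., a N; values of a beyond N are never used. *)
definition hom_poly :: "nat \<Rightarrow> (nat \<Rightarrow> complex) \<Rightarrow> complex \<times> complex \<Rightarrow> complex" where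
  "hom_poly N a = (\<lambda>(x, y). \<Sum>i\<le>N. a i * x ^ i * y ^ (N - i))"

definition bombieri_norm :: "nat \<Rightarrow> (nat \<Rightarrow> complex) \<Rightarrow> real" where
  "bombieri_norm N a = sqrt (\<Sum>i\<le>N. (cmod (a i))\<^sup>2 / real (N choose i))"

(* Orthogonality for the Hermitian product of \<complex>\<^sup>2; the library's inner product on
   complex \<times> complex is only its real part. *)
definition hermitian_perp :: "complex \<times> complex \<Rightarrow> (complex \<times> complex) set" where
  "hermitian_perp \<zeta> = {w. fst w * cnj (fst \<zeta>) + snd w * cnj (snd \<zeta>) = 0}"

(* \<zeta> is a nonzero representative of a projective zero; the value does not depend on its choice.
   The norm on complex \<times> complex is the Hermitian norm. The real Frechet derivative of a complex
   polynomial map is its complex derivative. The inverse is viewed as a map into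
   complex \<times> complex, which has the same operator norm. *)
definition mu_norm_hom :: "nat \<Rightarrow> (nat \<Rightarrow> complex) \<Rightarrow> complex \<times> complex \<Rightarrow> ereal" where
  "mu_norm_hom N a \<zeta> =
    (let D = frechet_derivative (hom_poly N a) (at \<zeta>);
         W = hermitian_perp \<zeta>
     in if bij_betw D W UNIV
        then ereal (sqrt (real N) * onorm (inv_into W D) * bombieri_norm N a * norm \<zeta> ^ (N - 1))
        else \<infinity>)"

definition mu_norm_at :: "complex poly \<Rightarrow> complex \<Rightarrow> ereal" where
  "mu_norm_at f z = mu_norm_hom (degree f) (coeff f) (z, 1)"

(* The set of zeros is finite and nonempty for nonconstant f. *)
definition mu_norm :: "complex poly \<Rightarrow> ereal" where
  "mu_norm f = Max (mu_norm_at f ` {z. poly f z = 0})"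

definition r_seq :: "nat \<Rightarrow> nat" where
  "r_seq j = 4 * j"

definition h_seq :: "nat \<Rightarrow> nat \<Rightarrow> real" where
  "h_seq N j = 1 - 4 * (real j)\<^sup>2 / real N"

definition rho :: "real \<Rightarrow> real" where
  "rho x = sqrt ((1 + x) / (1 - x))"

definition P_poly :: "nat \<Rightarrow> complex poly" where
  "P_poly M =
    (let N = 4 * M\<^sup>2 in
     (monom 1 (r_seq M) - 1) *
     (\<Prod>j\<in>{1..<M}.
        (monom 1 (r_seq j) - [:complex_of_real (rho (h_seq N j) ^ r_seq j):]) *
        (monom 1 (r_seq j) - [:complex_of_real (rho (h_seq N j) powi (- int (r_seq j))):])))"

end

theory Submission
  imports Defs
begin

text \<open>
  Put \<open>n = N / 2 = 2M\<^sup>2\<close> and \<open>s = |z|\<^sup>2\<close>. The squared radii of the circles of zeros are the rational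
  numbers \<open>(n - j\<^sup>2) / j\<^sup>2\<close>. In terms of \<open>F(z) = |P(z)| / (1 + |z|\<^sup>2) ^ n\<close>, a function on the Riemann sphere,
  the squared norm of \<open>P\<close> is \<open>N + 1\<close> times the mean of \<open>F\<^sup>2\<close>, and the condition number compares this mean
  with the value of \<open>F\<close> at a zero after removal of the vanishing factor. So it suffices that the mean of
  \<open>F\<^sup>2\<close> is at most a constant times the squares of all these values.

  This holds because the heights \<open>h\<^sub>j\<close> are the midpoints of parallel bands whose areas are proportional to
  the numbers \<open>r\<^sub>j\<close> of zeros: \<open>ln F\<close> is a midpoint rule for the logarithmic potential of the uniform measure,
  which is constant. Two things have to be controlled.

  First, each binomial \<open>z ^ r - c\<close> may be replaced by the larger of its two terms. Seen from circle \<open>k\<close>, the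
  other term of the binomial of circle \<open>j\<close> is smaller by a factor of at least \<open>(1 + |k - j|) ^ 4\<close>
  (\<open>radius_sq_ratio_power\<close>, by Bernoulli's inequality), so the product of all the corrections is bounded
  (\<open>prod_perturbed_upper\<close>, \<open>prod_perturbed_lower\<close>).

  Secondly, the product of the larger terms is explicit, and its behaviour from one circle or band to the
  next reduces to inequalities for logarithms. On the circles themselves it decreases towards the equator, even
  after the normalisation that occurs in the condition number (\<open>circle_value_antimono\<close>); with \<open>K\<close> for its value
  on the equator, the condition number at every zero is therefore at most \<open>||P|| / (3 K)\<close>
  (\<open>derivative_bound_outer\<close>, \<open>mu_norm_at_zero_le\<close>). Between the circles its maxima grow at most like the square
  root of \<open>M / k\<close> towards the pole (\<open>log_peak_bound\<close>), hence \<open>F\<^sup>2\<close> is at most a constant times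
  \<open>K\<^sup>2 \<surd>((1 + s) / 2)\<close> on the northern hemisphere (\<open>dominant_bound\<close>), and symmetrically on the southern one. The
  square root is integrable over the sphere, which gives \<open>||P||\<^sup>2 < 131 (N + 1) K\<^sup>2\<close>
  (\<open>bombieri_norm_le_dominant\<close>). The constant is good enough for both bounds as soon as \<open>M \<ge> 2\<close>; for \<open>M = 1\<close>
  the norm is computed.
\<close>

section \<open>Logarithmic inequalities\<close>

text \<open>
  Both sides vanish at 0, and the derivative of the difference is \<open>2 y\<^sup>4 / (1 - y\<^sup>2)\<close>. With
  \<open>y = (a - b) / (a + b)\<close> the right side is \<open>ln a - ln b\<close>; this is how logarithms of quotients of
  neighbouring quantities are bounded from below.
\<close>
lemma ln_artanh_lower:
  fixes y :: real assumes "0 \<le> y" "y < 1"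
  shows "2 * y + 2 / 3 * y ^ 3 \<le> ln (1 + y) - ln (1 - y)"
proof -
  let ?f = "\<lambda>y::real. ln (1 + y) - ln (1 - y) - (2 * y + 2 / 3 * y ^ 3)"
  have "?f 0 \<le> ?f y"
  proof (rule DERIV_nonneg_imp_nondecreasing[OF assms(1)])
    fix x :: real assume x: "0 \<le> x" "x \<le> y"
    then have x1: "0 < 1 - x" "0 < 1 + x" using assms by auto
    have pos: "0 < 1 - x\<^sup>2" using mult_pos_pos[OF x1] by (simp add: algebra_simps power2_eq_square)
    have "(?f has_real_derivative 2 * x ^ 4 / (1 - x\<^sup>2)) (at x)"
      using x1 pos by (auto intro!: derivative_eq_intros simp: divide_simps) (simp add: algebra_simps power_numeral_reduce)
    then show "\<exists>d. (?f has_real_derivative d) (at x) \<and> 0 \<le> d" using pos by (intro exI conjI) auto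
  qed
  then show ?thesis by simp
qed

lemma ln_artanh_upper:
  fixes y :: real assumes "0 \<le> y" "y \<le> 1 / 2"
  shows "ln (1 + y) - ln (1 - y) \<le> 2 * y + 4 / 3 * y ^ 3"
proof -
  let ?f = "\<lambda>y::real. 2 * y + 4 / 3 * y ^ 3 - (ln (1 + y) - ln (1 - y))"
  have "?f 0 \<le> ?f y"
  proof (rule DERIV_nonneg_imp_nondecreasing[OF assms(1)])
    fix x :: real assume x: "0 \<le> x" "x \<le> y"
    then have x1: "0 < 1 - x" "0 < 1 + x" using assms by auto
    have pos: "0 < 1 - x\<^sup>2" using mult_pos_pos[OF x1] by (simp add: algebra_simps power2_eq_square)
    have "x\<^sup>2 \<le> (1/2)\<^sup>2" using x assms by (intro power_mono) auto
    then have q: "0 \<le> 1 - 2 * x\<^sup>2" by (simp add: power2_eq_square)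
    have "(?f has_real_derivative 2 * x\<^sup>2 * (1 - 2 * x\<^sup>2) / (1 - x\<^sup>2)) (at x)"
      using x1 pos by (auto intro!: derivative_eq_intros simp: divide_simps) (simp add: algebra_simps power_numeral_reduce)
    then show "\<exists>d. (?f has_real_derivative d) (at x) \<and> 0 \<le> d" using pos q by (intro exI conjI) auto
  qed
  then show ?thesis by simp
qed

text \<open>
  The right side is the trapezoidal value of \<open>\<integral> dt / t\<close> over \<open>[1, 1 + x]\<close>, an overestimate because
  \<open>1 / t\<close> is convex.
\<close>
lemma ln_trapezoid_upper:
  fixes x :: real assumes "0 \<le> x"
  shows "ln (1 + x) \<le> x * (2 + x) / (2 * (1 + x))"
proof -
  let ?f = "\<lambda>x::real. (1 + x) / 2 - inverse (1 + x) / 2 - ln (1 + x)"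
  have "?f 0 \<le> ?f x"
  proof (rule DERIV_nonneg_imp_nondecreasing[OF assms(1)])
    fix t :: real assume t: "0 \<le> t" "t \<le> x"
    have "((\<lambda>x. inverse (1 + x)) has_real_derivative - (inverse (1 + t) * inverse (1 + t))) (at t)"
      "((\<lambda>x. ln (1 + x)) has_real_derivative inverse (1 + t)) (at t)"
      "((\<lambda>x. 1 + x) has_real_derivative 1) (at t)"
      using t by (auto intro!: derivative_eq_intros simp: divide_inverse)
    from DERIV_diff[OF DERIV_diff[OF DERIV_cdivide[OF this(3), of 2] DERIV_cdivide[OF this(1), of 2]] this(2)]
    have d: "(?f has_real_derivative (1 - inverse (1 + t))\<^sup>2 / 2) (at t)"
      by (rule DERIV_cong) (simp add: power2_eq_square algebra_simps diff_divide_distrib add_divide_distrib)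
    have "0 \<le> (1 - inverse (1 + t))\<^sup>2 / 2" by simp
    with d show "\<exists>d. (?f has_real_derivative d) (at t) \<and> 0 \<le> d" by blast
  qed
  moreover have "(1 + x) / 2 - inverse (1 + x) / 2 = x * (2 + x) / (2 * (1 + x))"
    using assms by (simp add: field_simps)
  ultimately show ?thesis by simp
qed

text \<open>
  The midpoint rule for the concave function \<open>ln\<close> on \<open>[1 - y, 1 + y]\<close>: the left side minus
  \<open>2 y\<close> is \<open>\<integral> ln t dt\<close>, and \<open>ln 1 = 0\<close> is the value at the midpoint.
\<close>
lemma entropy_odd_upper:
  fixes y :: real assumes "0 \<le> y" "y < 1"
  shows "(1 + y) * ln (1 + y) - (1 - y) * ln (1 - y) \<le> 2 * y"
proof -
  let ?f = "\<lambda>y::real. 2 * y - ((1 + y) * ln (1 + y) - (1 - y) * ln (1 - y))"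
  have "?f 0 \<le> ?f y"
  proof (rule DERIV_nonneg_imp_nondecreasing[OF assms(1)])
    fix x :: real assume x: "0 \<le> x" "x \<le> y"
    then have x1: "0 < 1 - x" "0 < 1 + x" using assms by auto
    have pos: "0 < 1 - x\<^sup>2" using mult_pos_pos[OF x1] by (simp add: algebra_simps power2_eq_square)
    have d: "(?f has_real_derivative - (ln (1 + x) + ln (1 - x))) (at x)"
      using x1 by (auto intro!: derivative_eq_intros simp: divide_simps)
    have "ln (1 + x) + ln (1 - x) = ln ((1 + x) * (1 - x))" using x1 by (simp add: ln_mult)
    also have "(1 + x) * (1 - x) = 1 - x\<^sup>2" by (simp add: algebra_simps power2_eq_square)
    finally have "ln (1 + x) + ln (1 - x) \<le> 0" using pos by (simp add: ln_le_zero_iff)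
    then have "0 \<le> - (ln (1 + x) + ln (1 - x))" by simp
    with d show "\<exists>d. (?f has_real_derivative d) (at x) \<and> 0 \<le> d" by blast
  qed
  then show ?thesis by simp
qed

text \<open>
  The second derivative of the left side is \<open>2 / (1 - y\<^sup>2)\<close>, at most \<open>2 + 4 y\<^sup>2\<close> in this range.
  The correction of order four is kept because the final constants leave little room for \<open>M = 2\<close>.
\<close>
lemma entropy_even_upper:
  fixes y :: real assumes "0 \<le> y" "y \<le> 1 / 2"
  shows "(1 + y) * ln (1 + y) + (1 - y) * ln (1 - y) \<le> y\<^sup>2 + y ^ 4 / 3"
proof -
  let ?f = "\<lambda>y::real. y\<^sup>2 + y ^ 4 / 3 - ((1 + y) * ln (1 + y) + (1 - y) * ln (1 - y))"
  have "?f 0 \<le> ?f y"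
  proof (rule DERIV_nonneg_imp_nondecreasing[OF assms(1)])
    fix x :: real assume x: "0 \<le> x" "x \<le> y"
    then have x1: "0 < 1 - x" "0 < 1 + x" using assms by auto
    have d: "(?f has_real_derivative 2 * x + 4 / 3 * x ^ 3 - (ln (1 + x) - ln (1 - x))) (at x)"
      using x1 by (auto intro!: derivative_eq_intros simp: divide_simps)
    have "0 \<le> 2 * x + 4 / 3 * x ^ 3 - (ln (1 + x) - ln (1 - x))"
      using ln_artanh_upper[of x] x assms by simp
    with d show "\<exists>d. (?f has_real_derivative d) (at x) \<and> 0 \<le> d" by blast
  qed
  then show ?thesis by simp
qed

section \<open>Squared radii of the circles of zeros\<close>

text \<open>
  The squared modulus of the zeros on circle \<open>j\<close>: \<open>\<rho>(h\<^sub>j)\<^sup>2\<close>, a rational number since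
  \<open>h\<^sub>j = 1 - j\<^sup>2 / M\<^sup>2\<close>. Circle \<open>j\<close> is the northern one; the equator is \<open>j = M\<close>.
\<close>
definition radius_sq :: "nat \<Rightarrow> nat \<Rightarrow> real" where
  "radius_sq M j = (2 * (real M)\<^sup>2 - (real j)\<^sup>2) / (real j)\<^sup>2"

lemma sq_le_sq_real: "j \<le> M \<Longrightarrow> (real j)\<^sup>2 \<le> (real M)\<^sup>2"
  by (simp add: power_mono)

lemma one_plus_radius_sq: "1 \<le> j \<Longrightarrow> 1 + radius_sq M j = 2 * (real M)\<^sup>2 / (real j)\<^sup>2"
  by (simp add: radius_sq_def divide_simps)

lemma radius_sq_self: "1 \<le> M \<Longrightarrow> radius_sq M M = 1"
  by (simp add: radius_sq_def)

lemma radius_sq_ge_1: assumes "1 \<le> j" "j \<le> M" shows "1 \<le> radius_sq M j"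
proof -
  have "0 < (real j)\<^sup>2" using assms by simp
  then show ?thesis using sq_le_sq_real[OF assms(2)] by (simp add: radius_sq_def divide_simps)
qed

lemma radius_sq_pos: "1 \<le> j \<Longrightarrow> j \<le> M \<Longrightarrow> 0 < radius_sq M j"
  using radius_sq_ge_1[of j M] by linarith

text \<open>
  For \<open>j\<close> far below \<open>M\<close> the radius is close to \<open>\<surd>2 M / j\<close>; the exact quotient only gains a factor
  \<open>(2M\<^sup>2 - k\<^sup>2) / (2M\<^sup>2 - j\<^sup>2) \<le> 1\<close>.
\<close>
lemma radius_sq_ratio_le:
  assumes "1 \<le> j" "j \<le> k" "k \<le> M"
  shows "radius_sq M k / radius_sq M j \<le> (real j / real k)\<^sup>2"
proof -
  let ?n = "2 * (real M)\<^sup>2"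
  have M0: "0 < (real M)\<^sup>2" using assms by simp
  have p: "0 < ?n - (real j)\<^sup>2" "0 \<le> ?n - (real k)\<^sup>2"
    using sq_le_sq_real[of j M] sq_le_sq_real[of k M] M0 assms by linarith+
  have "radius_sq M k / radius_sq M j = (real j / real k)\<^sup>2 * ((?n - (real k)\<^sup>2) / (?n - (real j)\<^sup>2))"
    by (simp add: radius_sq_def power_divide)
  also have "\<dots> \<le> (real j / real k)\<^sup>2 * 1"
    using p sq_le_sq_real[of j k] assms by (intro mult_left_mono) (auto simp: divide_le_eq_1)
  finally show ?thesis by simp
qed

lemma radius_sq_antimono: assumes "1 \<le> j" "j \<le> k" "k \<le> M" shows "radius_sq M k \<le> radius_sq M j"
proof -
  have "(real j / real k)\<^sup>2 \<le> 1\<^sup>2" using assms by (intro power_mono) (auto simp: divide_le_eq_1)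
  then have "radius_sq M k / radius_sq M j \<le> 1" using radius_sq_ratio_le[OF assms] by simp
  then show ?thesis using radius_sq_pos[of j M] assms by (simp add: divide_le_eq_1)
qed

text \<open>
  Bernoulli's inequality gives \<open>(k / j) ^ j \<ge> 1 + (k - j)\<close>. So the weaker term of the binomial
  belonging to circle \<open>j\<close>, seen from circle \<open>k\<close>, is smaller than the stronger one by a factor that depends
  only on the distance \<open>k - j\<close> and is summable over it.
\<close>
lemma radius_sq_ratio_power:
  assumes "1 \<le> j" "j \<le> k" "k \<le> M"
  shows "(radius_sq M k / radius_sq M j) ^ (2 * j) \<le> 1 / (1 + real (k - j)) ^ 4"
proof -
  have r0: "0 \<le> radius_sq M k / radius_sq M j" using radius_sq_pos[of j M] radius_sq_pos[of k M] assms by simp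
  have "1 + real (k - j) = 1 + real j * (real (k - j) / real j)" using assms by simp
  also have "\<dots> \<le> (1 + real (k - j) / real j) ^ j"
    by (rule Bernoulli_inequality) (smt (verit) divide_nonneg_nonneg of_nat_0_le_iff)
  also have "1 + real (k - j) / real j = real k / real j" using assms by (simp add: field_simps of_nat_diff)
  finally have B: "1 + real (k - j) \<le> (real k / real j) ^ j" .
  have "(radius_sq M k / radius_sq M j) ^ (2 * j) \<le> ((real j / real k)\<^sup>2) ^ (2 * j)"
    using radius_sq_ratio_le[OF assms] r0 by (intro power_mono)
  also have "\<dots> = 1 / ((real k / real j) ^ j) ^ 4"
    by (simp add: power_mult[symmetric] power_divide mult.commute)
  also have "\<dots> \<le> 1 / (1 + real (k - j)) ^ 4"
    using B assms by (intro divide_left_mono power_mono mult_pos_pos zero_less_power) auto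
  finally show ?thesis .
qed

lemma radius_sq_ratio_power':
  assumes "1 \<le> k" "k \<le> j" "j \<le> M"
  shows "(radius_sq M j / radius_sq M k) ^ (2 * j) \<le> 1 / (1 + real (j - k)) ^ 4"
proof -
  have r0: "0 \<le> radius_sq M j / radius_sq M k" using radius_sq_pos[of j M] radius_sq_pos[of k M] assms by simp
  have r1: "radius_sq M j / radius_sq M k \<le> 1" using radius_sq_antimono[OF assms] radius_sq_pos[of k M] assms by simp
  have "(radius_sq M j / radius_sq M k) ^ (2 * j) \<le> (radius_sq M j / radius_sq M k) ^ (2 * k)"
    using r0 r1 assms by (intro power_decreasing) auto
  also have "\<dots> \<le> 1 / (1 + real (j - k)) ^ 4" by (rule radius_sq_ratio_power[OF assms])
  finally show ?thesis .
qed

text \<open>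
  The value of the infinite sum is \<open>\<zeta>(4) - 1 = 0.0823...\<close>. The induction telescopes
  \<open>1 / x\<^sup>4 \<le> \<integral> t\<^sup>-\<^sup>4 dt\<close> over \<open>[x - 1/2, x + 1/2]\<close>, valid by convexity.
\<close>
lemma sum_inverse_fourth_initial: "(\<Sum>m=1..L. 1 / (1 + real m) ^ 4) \<le> 1 / 12"
proof (cases "L < 2")
  case True
  then have "L = 0 \<or> L = 1" by auto
  then show ?thesis by auto
next
  case False
  have "(\<Sum>m=1..L. 1 / (1 + real m) ^ 4) \<le> 1 / 12 - 1 / (3 * (real L + 3 / 2) ^ 3)"
    using False[unfolded not_less]
  proof (induction L rule: dec_induct)
    case base
    have "{1..2::nat} = {1, 2}" by auto
    then show ?case by (simp add: field_simps power_numeral_reduce)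
  next
    case (step L)
    define x a b where "x = real L + 2" and "a = x - 1 / 2" and "b = x + 1 / 2"
    have x: "4 \<le> x" using step.hyps by (simp add: x_def)
    have ab: "a * b \<le> x\<^sup>2" "0 < a" "0 < b" using x by (auto simp: a_def b_def power2_eq_square algebra_simps)
    have "1 / x ^ 4 = x\<^sup>2 / (x\<^sup>2) ^ 3" using x by (simp add: field_simps power_numeral_reduce)
    also have "\<dots> \<le> x\<^sup>2 / (a * b) ^ 3"
    proof (rule divide_left_mono)
      show "(a * b) ^ 3 \<le> (x\<^sup>2) ^ 3" using ab by (intro power_mono) auto
      show "0 < (x\<^sup>2) ^ 3 * (a * b) ^ 3" using ab x by (intro mult_pos_pos zero_less_power) auto
    qed simp
    also have "\<dots> \<le> (b ^ 3 - a ^ 3) / 3 / (a * b) ^ 3"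
    proof (rule divide_right_mono)
      show "x\<^sup>2 \<le> (b ^ 3 - a ^ 3) / 3" by (simp add: a_def b_def power_numeral_reduce algebra_simps)
      show "0 \<le> (a * b) ^ 3" using ab by simp
    qed
    also have "\<dots> = 1 / (3 * a ^ 3) - 1 / (3 * b ^ 3)"
      using ab by (simp add: diff_divide_distrib power_mult_distrib)
    finally have *: "1 / x ^ 4 \<le> 1 / (3 * a ^ 3) - 1 / (3 * b ^ 3)" .
    have e: "1 + real (Suc L) = x" "real L + 3 / 2 = a" "real (Suc L) + 3 / 2 = b"
      by (auto simp: x_def a_def b_def)
    have "(\<Sum>m=1..Suc L. 1 / (1 + real m) ^ 4) = (\<Sum>m=1..L. 1 / (1 + real m) ^ 4) + 1 / x ^ 4"
      using e(1) by simp
    then show ?case using * step.IH unfolding e by linarith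
  qed
  also have "\<dots> \<le> 1 / 12" by simp
  finally show ?thesis .
qed

lemma sum_inverse_fourth:
  fixes g :: "nat \<Rightarrow> nat"
  assumes "finite A" "inj_on g A" "\<And>j. j \<in> A \<Longrightarrow> 1 \<le> g j"
  shows "(\<Sum>j\<in>A. 1 / (1 + real (g j)) ^ 4) \<le> 1 / 12"
proof -
  define L where "L = Max (g ` A)"
  have L: "g j \<le> L" if "j \<in> A" for j using assms(1) that by (simp add: L_def)
  have "(\<Sum>j\<in>A. 1 / (1 + real (g j)) ^ 4) = (\<Sum>m\<in>g ` A. 1 / (1 + real m) ^ 4)"
    using assms(2) by (simp add: sum.reindex)
  also have "\<dots> \<le> (\<Sum>m=1..L. 1 / (1 + real m) ^ 4)"
    using L assms(3) by (intro sum_mono2) auto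
  also have "\<dots> \<le> 1 / 12" by (rule sum_inverse_fourth_initial)
  finally show ?thesis .
qed

lemma prod_one_minus_ge:
  fixes q :: "'a \<Rightarrow> real"
  assumes "finite A" "\<And>j. j \<in> A \<Longrightarrow> 0 \<le> q j \<and> q j \<le> 1"
  shows "1 - sum q A \<le> (\<Prod>j\<in>A. 1 - q j)"
  using assms
proof (induction A)
  case (insert x A)
  have "(\<Prod>j\<in>A. 1 - q j) \<le> 1" using insert.prems by (intro prod_le_1) auto
  then have "q x * (\<Prod>j\<in>A. 1 - q j) \<le> q x * 1" using insert.prems by (intro mult_left_mono) auto
  then show ?case using insert by (simp add: algebra_simps)
qed simp

text \<open>
  A product over circles in which factor \<open>j\<close> is \<open>c j\<close> up to a relative error of at most \<open>(1 + distance)\<^sup>-\<^sup>4\<close>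
  agrees with the product of the \<open>c j\<close> up to a constant, however many circles there are. Here \<open>g j\<close> is the
  distance from circle \<open>j\<close> to the observer.
\<close>
lemma prod_perturbed_upper:
  fixes g :: "nat \<Rightarrow> nat" and f c :: "nat \<Rightarrow> real"
  assumes "finite A" "inj_on g A" "\<And>j. j \<in> A \<Longrightarrow> 1 \<le> g j"
    and "\<And>j. j \<in> A \<Longrightarrow> 0 \<le> c j" "\<And>j. j \<in> A \<Longrightarrow> 0 \<le> f j"
    and "\<And>j. j \<in> A \<Longrightarrow> f j \<le> c j * (1 + 1 / (1 + real (g j)) ^ 4)"
  shows "prod f A \<le> prod c A * exp (1 / 12)"
proof -
  have "prod f A \<le> (\<Prod>j\<in>A. c j * (1 + 1 / (1 + real (g j)) ^ 4))"
    using assms by (intro prod_mono) auto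
  also have "\<dots> = prod c A * (\<Prod>j\<in>A. 1 + 1 / (1 + real (g j)) ^ 4)" by (rule prod.distrib)
  also have "\<dots> \<le> prod c A * exp (\<Sum>j\<in>A. 1 / (1 + real (g j)) ^ 4)"
    using assms by (intro mult_left_mono prod_le_exp_sum prod_nonneg) auto
  also have "\<dots> \<le> prod c A * exp (1 / 12)"
    using assms sum_inverse_fourth[OF assms(1-3)] by (intro mult_left_mono prod_nonneg) auto
  finally show ?thesis .
qed

lemma prod_perturbed_lower:
  fixes g :: "nat \<Rightarrow> nat" and f c :: "nat \<Rightarrow> real"
  assumes "finite A" "inj_on g A" "\<And>j. j \<in> A \<Longrightarrow> 1 \<le> g j"
    and "\<And>j. j \<in> A \<Longrightarrow> 0 \<le> c j"
    and "\<And>j. j \<in> A \<Longrightarrow> c j * (1 - 1 / (1 + real (g j)) ^ 4) \<le> f j"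
  shows "11 / 12 * prod c A \<le> prod f A"
proof -
  have le1: "0 \<le> 1 / (1 + real m) ^ 4 \<and> 1 / (1 + real m) ^ 4 \<le> 1" for m
    by (simp add: divide_le_eq_1)
  have "11 / 12 * prod c A \<le> prod c A * (1 - (\<Sum>j\<in>A. 1 / (1 + real (g j)) ^ 4))"
    using mult_left_mono[OF sum_inverse_fourth[OF assms(1-3)], of "prod c A"] assms
    by (simp add: prod_nonneg algebra_simps)
  also have "\<dots> \<le> prod c A * (\<Prod>j\<in>A. 1 - 1 / (1 + real (g j)) ^ 4)"
    using assms le1 by (intro mult_left_mono prod_one_minus_ge prod_nonneg) auto
  also have "\<dots> = (\<Prod>j\<in>A. c j * (1 - 1 / (1 + real (g j)) ^ 4))" by (rule prod.distrib[symmetric])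
  also have "\<dots> \<le> prod f A"
    using assms le1 by (intro prod_mono conjI mult_nonneg_nonneg) auto
  finally show ?thesis .
qed

section \<open>Logarithmic potential on the circles and between them\<close>

lemma ln_radius_sq: assumes "1 \<le> j" "j \<le> M"
  shows "ln (radius_sq M j) = ln (2 * (real M)\<^sup>2 - (real j)\<^sup>2) - 2 * ln (real j)"
    "ln (1 + radius_sq M j) = ln (2 * (real M)\<^sup>2) - 2 * ln (real j)"
proof -
  have M0: "0 < (real M)\<^sup>2" using assms by simp
  have "0 < 2 * (real M)\<^sup>2 - (real j)\<^sup>2" using sq_le_sq_real[OF assms(2)] M0 by linarith
  then show "ln (radius_sq M j) = ln (2 * (real M)\<^sup>2 - (real j)\<^sup>2) - 2 * ln (real j)"
    using assms by (simp add: radius_sq_def ln_div ln_realpow)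
  show "ln (1 + radius_sq M j) = ln (2 * (real M)\<^sup>2) - 2 * ln (real j)"
    using assms by (subst one_plus_radius_sq[OF assms(1)], subst ln_div) (auto simp: ln_realpow)
qed

definition log_radius_sum :: "nat \<Rightarrow> nat \<Rightarrow> real" where
  "log_radius_sum M k = (\<Sum>j=1..k. 2 * real j * ln (radius_sq M j))"

text \<open>
  The size of \<open>|P(z)| / (1 + |z|\<^sup>2) ^ (N / 2)\<close> on circle \<open>k\<close> when every binomial \<open>z ^ r - c\<close> is replaced by its
  larger term: on this circle that term is \<open>c\<close> for the circles \<open>j < k\<close> and \<open>z ^ r\<close> for all others.
\<close>
definition circle_value :: "nat \<Rightarrow> nat \<Rightarrow> real" where
  "circle_value M k = radius_sq M k ^ (2 * M\<^sup>2 - k * (k - 1)) * (\<Prod>j=1..<k. radius_sq M j ^ (2 * j)) / (1 + radius_sq M k) ^ (2 * M\<^sup>2)"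

lemma pred_product_le: "k \<le> M \<Longrightarrow> k * (k - 1) \<le> 2 * M\<^sup>2" for k M :: nat
  by (metis diff_le_self le_trans mult_le_mono mult_2 power2_eq_square le_add1)

lemma prod_radius_sq_eq_exp:
  assumes "k \<le> M"
  shows "(\<Prod>j=1..k. radius_sq M j ^ (2 * j)) = exp (log_radius_sum M k)"
  unfolding log_radius_sum_def exp_sum[OF finite_atLeastAtMost]
proof (rule prod.cong[OF refl])
  fix j assume "j \<in> {1..k}"
  then have "0 < radius_sq M j" using assms by (intro radius_sq_pos) auto
  then show "radius_sq M j ^ (2 * j) = exp (2 * real j * ln (radius_sq M j))"
    by (metis exp_ln exp_of_nat_mult of_nat_mult of_nat_numeral)
qed

lemma circle_value_pos: "1 \<le> k \<Longrightarrow> k \<le> M \<Longrightarrow> 0 < circle_value M k"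
  unfolding circle_value_def using radius_sq_pos[of _ M]
  by (intro divide_pos_pos mult_pos_pos prod_pos zero_less_power add_pos_pos) auto

lemma ln_circle_value:
  assumes "1 \<le> k" "k \<le> M"
  shows "ln (circle_value M k) = (2 * (real M)\<^sup>2 - real k * (real k - 1)) * ln (radius_sq M k)
    + log_radius_sum M (k - 1) - 2 * (real M)\<^sup>2 * ln (1 + radius_sq M k)"
proof -
  have s: "0 < radius_sq M k" using radius_sq_pos assms by auto
  have i: "{1..<k} = {1..k - 1}" using assms by auto
  have P: "(\<Prod>j=1..<k. radius_sq M j ^ (2 * j)) = exp (log_radius_sum M (k - 1))"
    unfolding i using assms by (intro prod_radius_sq_eq_exp) auto
  have r: "real (2 * M\<^sup>2 - k * (k - 1)) = 2 * (real M)\<^sup>2 - real k * (real k - 1)"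
    using pred_product_le[OF assms(2)] assms by (simp add: of_nat_diff)
  show ?thesis unfolding circle_value_def P r[symmetric] using s
    by (simp add: ln_mult ln_div ln_realpow)
qed

lemma log_radius_sum_Suc: "log_radius_sum M (Suc k) = log_radius_sum M k + 2 * real (Suc k) * ln (radius_sq M (Suc k))"
  by (simp add: log_radius_sum_def)

text \<open>
  With \<open>a = n - k\<^sup>2\<close>, \<open>b = n - (k+1)\<^sup>2\<close>, \<open>n = 2M\<^sup>2\<close>, the difference of the two sides telescopes to
  \<open>(a + b) (ln a - ln b) - 4k(k+1) ln ((k+1) / k)\<close>. The first part is at least \<open>2 (2k+1)\<close> by the artanh
  bound, the second at most that much by the trapezoidal bound. The normalisation by \<open>n - k\<^sup>2\<close> is the one
  that occurs in the condition number, and it makes the first estimate fit exactly.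
\<close>
lemma circle_value_step:
  assumes "1 \<le> k" "k < M"
  shows "2 * ln (circle_value M (Suc k)) - ln (2 * (real M)\<^sup>2 - (real (Suc k))\<^sup>2)
    \<le> 2 * ln (circle_value M k) - ln (2 * (real M)\<^sup>2 - (real k)\<^sup>2)"
proof -
  define n a b x where "n = 2 * (real M)\<^sup>2" and "a = n - (real k)\<^sup>2"
    and "b = n - (real (Suc k))\<^sup>2" and "x = real k"
  have M0: "0 < (real M)\<^sup>2" and x: "1 \<le> x" using assms by (auto simp: x_def)
  have b0: "0 < b" using sq_le_sq_real[of "Suc k" M] M0 assms unfolding b_def n_def by linarith
  have ab: "a - b = 2 * x + 1" "a + b = 2 * (n - x * (x + 1)) - 1"
    by (simp_all add: a_def b_def x_def power2_eq_square algebra_simps)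
  have a0: "0 < a" using ab(1) b0 x by linarith
  have L1: "2 * (2 * x + 1) \<le> (a + b) * (ln a - ln b)"
  proof -
    define y where "y = (a - b) / (a + b)"
    have y: "0 \<le> y" "y < 1" using ab b0 a0 x by (auto simp: y_def)
    define h where "h = 2 / (a + b)"
    have h: "0 < h" using a0 b0 by (simp add: h_def)
    have e: "1 + y = a * h" "1 - y = b * h"
      using a0 b0 by (simp_all add: y_def h_def field_simps)
    have "ln (1 + y) - ln (1 - y) = ln a - ln b"
      unfolding e using a0 b0 h by (simp add: ln_mult_pos)
    then have "2 * y + 2 / 3 * y ^ 3 \<le> ln a - ln b" using ln_artanh_lower[OF y] by simp
    then have "2 * y \<le> ln a - ln b" using y(1) by (smt (verit) zero_le_power mult_nonneg_nonneg divide_nonneg_nonneg)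
    then have "(a + b) * (2 * y) \<le> (a + b) * (ln a - ln b)" using a0 b0 by (intro mult_left_mono) auto
    then show ?thesis using ab a0 b0 by (simp add: y_def)
  qed
  have L2: "2 * x * (x + 1) * (ln (x + 1) - ln x) \<le> 2 * x + 1"
  proof -
    have "1 + 1 / x = (x + 1) / x" using x by (simp add: field_simps)
    then have "ln (x + 1) - ln x = ln (1 + 1 / x)" using x by (simp add: ln_div)
    also have "\<dots> \<le> (1 / x) * (2 + 1 / x) / (2 * (1 + 1 / x))" using x by (intro ln_trapezoid_upper) auto
    also have "\<dots> = (2 * x + 1) / (2 * x * (x + 1))"
      using x by (simp add: divide_eq_eq eq_divide_eq) (simp add: field_simps)
    finally have "ln (x + 1) - ln x \<le> (2 * x + 1) / (2 * x * (x + 1))" .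
    moreover have "0 < 2 * x * (x + 1)" using x by simp
    ultimately have "(ln (x + 1) - ln x) * (2 * x * (x + 1)) \<le> 2 * x + 1" by (simp only: pos_le_divide_eq)
    then show ?thesis by (simp only: mult.commute)
  qed
  have k1: "k - 1 \<ge> 0" "Suc (k - 1) = k" using assms by auto
  have V: "ln (circle_value M k) = (n - x * (x - 1)) * (ln a - 2 * ln x) + log_radius_sum M (k - 1) - n * (ln n - 2 * ln x)"
    using ln_circle_value[of k M] ln_radius_sq[of k M] assms by (simp add: n_def a_def x_def)
  have S: "log_radius_sum M k = log_radius_sum M (k - 1) + 2 * x * (ln a - 2 * ln x)"
    using log_radius_sum_Suc[of M "k - 1"] k1 ln_radius_sq[of k M] assms by (simp add: n_def a_def x_def)
  have V': "ln (circle_value M (Suc k)) = (n - (x + 1) * x) * (ln b - 2 * ln (x + 1)) + log_radius_sum M k - n * (ln n - 2 * ln (x + 1))"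
    using ln_circle_value[of "Suc k" M] ln_radius_sq[of "Suc k" M] assms by (simp add: n_def b_def x_def add.commute)
  have "2 * ln (circle_value M k) - ln a - (2 * ln (circle_value M (Suc k)) - ln b)
     = (a + b) * (ln a - ln b) - 2 * (2 * x * (x + 1) * (ln (x + 1) - ln x))"
    unfolding V V' S ab by (simp add: algebra_simps)
  moreover define t where "t = (a + b) * (ln a - ln b)"
  moreover define t' where "t' = 2 * x * (x + 1) * (ln (x + 1) - ln x)"
  ultimately have "2 * ln (circle_value M (Suc k)) - ln b \<le> 2 * ln (circle_value M k) - ln a"
    using L1 L2 by simp
  then show ?thesis unfolding a_def b_def n_def .
qed

text \<open>
  Summed over the circles, the step shows that the equator \<open>k = M\<close>, where \<open>n - M\<^sup>2 = M\<^sup>2\<close>, is the worst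
  circle for the condition number.
\<close>
lemma circle_value_antimono:
  assumes "1 \<le> k" "k \<le> M"
  shows "(2 * (real M)\<^sup>2 - (real k)\<^sup>2) * (circle_value M M)\<^sup>2 \<le> (real M)\<^sup>2 * (circle_value M k)\<^sup>2"
proof -
  have L: "2 * ln (circle_value M M) - ln (2 * (real M)\<^sup>2 - (real M)\<^sup>2)
    \<le> 2 * ln (circle_value M k) - ln (2 * (real M)\<^sup>2 - (real k)\<^sup>2)"
    using assms(2,1)
  proof (induction k rule: inc_induct)
    case (step k)
    then show ?case using circle_value_step[of k M] by simp
  qed simp
  have M0: "0 < (real M)\<^sup>2" using assms by simp
  have p: "0 < 2 * (real M)\<^sup>2 - (real k)\<^sup>2" using sq_le_sq_real[OF assms(2)] M0 by linarith
  have c: "0 < circle_value M M" "0 < circle_value M k" using circle_value_pos assms by auto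
  have "ln ((2 * (real M)\<^sup>2 - (real k)\<^sup>2) * (circle_value M M)\<^sup>2) \<le> ln ((real M)\<^sup>2 * (circle_value M k)\<^sup>2)"
    using L p c M0 by (simp add: ln_mult ln_realpow)
  then show ?thesis using p c M0 by (subst (asm) ln_le_cancel_iff) auto
qed

text \<open>
  Between circles \<open>k\<close> and \<open>k + 1\<close> the product of the larger terms, divided by \<open>(1 + s) ^ n\<close> with
  \<open>s = |z|\<^sup>2\<close> and \<open>n = N / 2\<close>, is a constant times \<open>s ^ u / (1 + s) ^ n\<close>. This is the logarithm of its maximum,
  attained at \<open>s = u / v\<close>. For \<open>k = 0\<close>, the cap around the pole, the convention
  \<open>0 * ln 0 = 0\<close> gives the supremum.
\<close>
definition log_peak :: "nat \<Rightarrow> nat \<Rightarrow> real" where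
  "log_peak M k = (let n = 2 * (real M)\<^sup>2; v = real k * (real k + 1); u = n - v
     in u * ln u + v * ln v - n * ln n + log_radius_sum M k)"

text \<open>
  From one band to the next, the contributions of the two poles separate. The difference is the sum of two errors
  of the midpoint rule for \<open>ln\<close>: the one on an interval around \<open>n - k\<^sup>2\<close> (southern pole) is not positive, and the
  one on an interval around \<open>k\<^sup>2\<close> (northern pole), about \<open>1 / (3k)\<close>, remains on the right.
\<close>
lemma log_peak_diff:
  assumes "1 \<le> k" "k < M"
  shows "log_peak M (k - 1) - log_peak M k
    \<le> 2 * real k - real k * (real k + 1) * (ln (real k + 1) - ln (real k))
      - real k * (real k - 1) * (ln (real k) - ln (real k - 1))"
proof -
  define n c x where "n = 2 * (real M)\<^sup>2" and "c = n - (real k)\<^sup>2" and "x = real k"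
  have x: "1 \<le> x" using assms by (simp add: x_def)
  have "real (Suc k) \<le> real M" using assms by linarith
  then have "x + 1 \<le> real M" by (simp add: x_def)
  then have "(x + 1)\<^sup>2 \<le> (real M)\<^sup>2" using x by (intro power_mono) auto
  then have "x\<^sup>2 + 2 * x + 1 \<le> (real M)\<^sup>2" by (simp add: power2_eq_square algebra_simps)
  then have cx: "x < c" using x zero_le_power2[of x] unfolding c_def n_def x_def[symmetric] by linarith
  define y where "y = x / c"
  have y: "0 \<le> y" "y < 1" using x cx by (auto simp: y_def)
  have cy: "c + x = c * (1 + y)" "c - x = c * (1 - y)" using x cx by (simp_all add: y_def field_simps)
  have l: "ln (c * (1 + y)) = ln c + ln (1 + y)" "ln (c * (1 - y)) = ln c + ln (1 - y)"
    using x cx y by (simp_all add: ln_mult_pos)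
  have k1: "real (k - 1) = x - 1" "Suc (k - 1) = k" using assms by (auto simp: x_def)
  have S: "log_radius_sum M k = log_radius_sum M (k - 1) + 2 * x * (ln c - 2 * ln x)"
    using log_radius_sum_Suc[of M "k - 1"] k1 ln_radius_sq[of k M] assms by (simp add: n_def c_def x_def)
  have e: "n - (x - 1) * (x - 1 + 1) = c + x" "n - x * (x + 1) = c - x"
    by (simp_all add: c_def x_def power2_eq_square algebra_simps)
  have "(c + x) * ln (c + x) - (c - x) * ln (c - x) - 2 * x * ln c
     = c * ((1 + y) * ln (1 + y) - (1 - y) * ln (1 - y)) + (c * (1 + y) - c * (1 - y) - 2 * x) * ln c"
    unfolding cy l by (simp add: algebra_simps)
  also have "c * (1 + y) - c * (1 - y) - 2 * x = 0" unfolding cy[symmetric] by simp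
  also have "c * ((1 + y) * ln (1 + y) - (1 - y) * ln (1 - y)) + 0 * ln c \<le> c * (2 * y)"
    using entropy_odd_upper[OF y] x cx by simp
  also have "c * (2 * y) = 2 * x" using x cx by (simp add: y_def)
  finally have south: "(c + x) * ln (c + x) - (c - x) * ln (c - x) - 2 * x * ln c \<le> 2 * x" .
  \<comment> \<open>For \<open>x = 1\<close> both sides vanish, whatever the value of \<open>ln 0\<close>.\<close>
  have l1: "(x - 1) * x * ln ((x - 1) * x) = (x - 1) * x * (ln (x - 1) + ln x)"
    using x by (cases "x = 1") (auto simp: ln_mult)
  have l2: "x * (x + 1) * ln (x * (x + 1)) = x * (x + 1) * (ln x + ln (x + 1))"
    using x by (simp add: ln_mult)
  have P: "log_peak M k = (c - x) * ln (c - x) + x * (x + 1) * (ln x + ln (x + 1)) - n * ln n + log_radius_sum M k"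
    unfolding log_peak_def Let_def n_def[symmetric] x_def[symmetric] e l2 ..
  have P': "log_peak M (k - 1) = (c + x) * ln (c + x) + (x - 1) * x * (ln (x - 1) + ln x) - n * ln n + log_radius_sum M (k - 1)"
    unfolding log_peak_def Let_def n_def[symmetric] k1 e using l1 by simp
  show ?thesis unfolding P P' S x_def[symmetric] using south by (simp add: algebra_simps)
qed

text \<open>
  The increment \<open>1 / (3k)\<close> towards the pole is less than \<open>ln ((k + 1) / k) / 2\<close>, so the peaks grow at
  most like the inverse square root of the distance to the pole; their squares then stay integrable over the sphere.
  The comparison needs the cubic term of the artanh bound: with the linear term alone it
  fails by a quantity of order \<open>1 / k\<^sup>2\<close>.
\<close>
lemma log_peak_step:
  assumes "2 \<le> k" "k < M"
  shows "2 * log_peak M (k - 1) + ln (real k) \<le> 2 * log_peak M k + ln (real k + 1)"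
proof -
  define x where "x = real k"
  have x: "2 \<le> x" using assms by (simp add: x_def)
  define p q where "p = ln (x + 1) - ln x" and "q = ln x - ln (x - 1)"
  have A: "2 * (1 / (2 * z - 1)) + 2 / 3 * (1 / (2 * z - 1)) ^ 3 \<le> ln z - ln (z - 1)" if "1 < z" for z :: real
  proof -
    define h where "h = 2 / (2 * z - 1)"
    have h: "0 < h" using that by (simp add: h_def)
    have e: "1 + 1 / (2 * z - 1) = z * h" "1 - 1 / (2 * z - 1) = (z - 1) * h"
      using that by (simp_all add: h_def field_simps)
    have "ln (1 + 1 / (2 * z - 1)) - ln (1 - 1 / (2 * z - 1)) = ln z - ln (z - 1)"
      unfolding e using that h by (simp add: ln_mult_pos)
    then show ?thesis using ln_artanh_lower[of "1 / (2 * z - 1)"] that by simp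
  qed
  \<comment> \<open>The artanh arguments of the quotients \<open>x / (x - 1)\<close> and \<open>(x + 1) / x\<close>.\<close>
  define s t where "s = 1 / (2 * x - 1)" and "t = 1 / (2 * x + 1)"
  have q: "2 * s + 2 / 3 * s ^ 3 \<le> q" using A[of x] x by (simp add: q_def s_def)
  have p: "2 * t + 2 / 3 * t ^ 3 \<le> p" using A[of "x + 1"] x by (simp add: p_def t_def add.commute)
  have qm: "x * (x - 1) * (2 * s + 2 / 3 * s ^ 3) \<le> x * (x - 1) * q" using q x by (intro mult_left_mono) auto
  have pm: "(x * (x + 1) + 1 / 2) * (2 * t + 2 / 3 * t ^ 3) \<le> (x * (x + 1) + 1 / 2) * p" using p x by (intro mult_left_mono) auto
  have es: "(2 * x - 1) * s = 1" and et: "(2 * x + 1) * t = 1" using x by (auto simp: s_def t_def)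
  have pos: "0 < s" "0 < t" using x by (auto simp: s_def t_def)
  have xs: "x = 1 / (2 * s) + 1 / 2" using x by (simp add: s_def field_simps)
  have xt: "x = 1 / (2 * t) - 1 / 2" using x by (simp add: t_def field_simps)
  have "x * (x - 1) = (1 / s\<^sup>2 - 1) / 4" unfolding xs using pos by (simp add: field_simps power2_eq_square)
  then have eq1: "x * (x - 1) * (2 * s + 2 / 3 * s ^ 3) = (x - 1 / 2) - s / 3 - s ^ 3 / 6"
    unfolding xs using pos by (simp add: field_simps power_numeral_reduce)
  have "x * (x + 1) + 1 / 2 = (1 / t\<^sup>2 + 1) / 4" unfolding xt using pos by (simp add: field_simps power2_eq_square)
  then have eq2: "(x * (x + 1) + 1 / 2) * (2 * t + 2 / 3 * t ^ 3) = (x + 1 / 2) + 2 / 3 * t + t ^ 3 / 6"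
    unfolding xt using pos by (simp add: field_simps power_numeral_reduce)
  have "s / 3 + s ^ 3 / 6 \<le> 2 / 3 * t + t ^ 3 / 6"
  proof -
    have "s \<le> 1 / 3" using x by (simp add: s_def divide_simps)
    then have "s\<^sup>2 \<le> (1 / 3)\<^sup>2" using pos by (intro power_mono) auto
    then have "s * s\<^sup>2 \<le> s * (1 / 9)" using pos by (intro mult_left_mono) (auto simp: power2_eq_square)
    then have "s ^ 3 \<le> s / 9" by (simp add: power_numeral_reduce)
    moreover have "s \<le> 5 / 3 * t" using x by (simp add: s_def t_def divide_simps)
    moreover have "0 \<le> t ^ 3" using pos by simp
    ultimately show ?thesis using pos by linarith
  qed
  then have "2 * x \<le> x * (x - 1) * q + (x * (x + 1) + 1 / 2) * p" using qm pm eq1 eq2 by linarith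
  then have "2 * x - x * (x + 1) * p - x * (x - 1) * q \<le> p / 2" by (simp add: algebra_simps)
  then have "log_peak M (k - 1) - log_peak M k \<le> p / 2"
    using log_peak_diff[of k M] assms unfolding p_def q_def x_def by simp
  then show ?thesis unfolding p_def x_def by simp
qed

lemma log_peak_0: "1 \<le> M \<Longrightarrow> log_peak M 0 = 0"
  by (simp add: log_peak_def log_radius_sum_def)

text \<open>
  The band next to the equator: there the potential is lower than at the peak of the band by
  \<open>M\<^sup>2 ((1 + y) ln (1 + y) + (1 - y) ln (1 - y))\<close> with \<open>y = 1 / M\<close>, that is by about 1.
\<close>
lemma log_peak_last:
  assumes "2 \<le> M"
  shows "log_peak M (M - 1) \<le> ln (circle_value M M) + 13 / 12"
proof -
  define m y where "m = (real M)\<^sup>2" and "y = 1 / real M"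
  have m: "0 < m" and M: "2 \<le> real M" using assms by (auto simp: m_def)
  have y: "0 \<le> y" "y \<le> 1 / 2" using M by (auto simp: y_def divide_simps)
  have r: "real (M - 1) = real M - 1" using assms by auto
  have e1: "2 * m - m * (1 - y) = m * (1 + y)" "(real M - 1) * (real M - 1 + 1) = m * (1 - y)"
    using M by (simp_all add: m_def y_def power2_eq_square algebra_simps)
  have c: "ln (circle_value M M) = log_radius_sum M (M - 1) - 2 * m * ln 2"
    using ln_circle_value[of M M] assms by (simp add: radius_sq_self m_def)
  have l: "ln (m * (1 + y)) = ln m + ln (1 + y)" "ln (m * (1 - y)) = ln m + ln (1 - y)" "ln (2 * m) = ln 2 + ln m"
    using m y by (simp_all add: ln_mult_pos)
  have "log_peak M (M - 1) - ln (circle_value M M) = m * ((1 + y) * ln (1 + y) + (1 - y) * ln (1 - y))"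
    unfolding log_peak_def Let_def r m_def[symmetric] e1 c l by (simp add: algebra_simps)
  also have "\<dots> \<le> m * (y\<^sup>2 + y ^ 4 / 3)"
    using entropy_even_upper[OF y] m by (intro mult_left_mono) auto
  also have "\<dots> = 1 + y\<^sup>2 / 3" using M by (simp add: m_def y_def field_simps power_numeral_reduce)
  also have "\<dots> \<le> 1 + (1 / 2)\<^sup>2 / 3" using y by (intro add_left_mono divide_right_mono power_mono) auto
  finally show ?thesis by (simp add: power2_eq_square)
qed

lemma log_peak_bound:
  assumes "1 \<le> k" "k < M"
  shows "2 * log_peak M k + ln (real k + 1) \<le> 2 * ln (circle_value M M) + ln (real M) + 13 / 6"
proof -
  have "k \<le> M - 1" using assms by auto
  then have "2 * log_peak M k + ln (real k + 1) \<le> 2 * log_peak M (M - 1) + ln (real (M - 1) + 1)"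
    using assms(1)
  proof (induction k rule: inc_induct)
    case (step k)
    then have "Suc k < M" "1 \<le> k" by auto
    then show ?case using step log_peak_step[of "Suc k" M] by (simp add: add.commute)
  qed simp
  then show ?thesis using log_peak_last[of M] assms by (simp add: of_nat_diff)
qed

text \<open>
  The same bound for the polar cap, whose peak has logarithm 0. Here the first increment of the peaks is
  \<open>2 - 2 ln 2\<close>, which is too large for the square-root growth law, so it is kept explicitly.
\<close>
lemma log_peak_cap:
  assumes "2 \<le> M"
  shows "5 * ln 2 - 4 \<le> 2 * ln (circle_value M M) + ln (real M) + 13 / 6"
  using log_peak_diff[of 1 M] log_peak_0[of M] log_peak_bound[of 1 M] assms by simp

section \<open>A majorant of the polynomial\<close>

lemma sum_twice: "(\<Sum>j=1..k. 2 * j) = k * (k + 1)" for k :: nat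
  by (induction k) auto

text \<open>
  In powers of \<open>s = |z|\<^sup>2\<close> the whole polynomial has degree \<open>2M\<^sup>2\<close>, of which the circles \<open>1, ..., k\<close>
  account for \<open>k (k + 1)\<close>.
\<close>
lemma exponents_total:
  fixes k M :: nat
  assumes "k \<le> M"
  shows "(\<Sum>j\<in>{k<..M}. 2 * j) + (\<Sum>j=1..<M. 2 * j) = 2 * M\<^sup>2 - k * (k + 1)"
proof -
  have "{1..M} = {1..k} \<union> {k<..M}" using assms by auto
  then have "(\<Sum>j=1..M. 2 * j) = (\<Sum>j=1..k. 2 * j) + (\<Sum>j\<in>{k<..M}. 2 * j)"
    by (simp add: sum.union_disjoint ivl_disj_int)
  then have "M * (M + 1) = k * (k + 1) + (\<Sum>j\<in>{k<..M}. 2 * j)" unfolding sum_twice .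
  moreover have "(\<Sum>j=1..<M. 2 * j) = M * (M - 1)"
  proof (cases M)
    case (Suc m)
    then have "{1..<M} = {1..m}" by auto
    then show ?thesis using Suc sum_twice[of m] by (simp add: mult.commute)
  qed simp
  moreover have "M * (M + 1) + M * (M - 1) = 2 * M\<^sup>2" by (cases M) (auto simp: power2_eq_square)
  ultimately show ?thesis by linarith
qed

text \<open>
  The polynomial \<open>P\<close> with all signs made positive, as a function of \<open>s = |z|\<^sup>2\<close>. At \<open>j = M\<close> the radius is 1, which
  gives the equatorial factor.
\<close>
definition dominant :: "nat \<Rightarrow> real \<Rightarrow> real" where
  "dominant M s = (\<Prod>j=1..M. s ^ (2 * j) + radius_sq M j ^ (2 * j)) * (\<Prod>j=1..<M. s ^ (2 * j) + (1 / radius_sq M j) ^ (2 * j))"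

lemma dominant_south_upper:
  assumes "1 \<le> M" "1 \<le> s"
  shows "(\<Prod>j=1..<M. s ^ (2 * j) + (1 / radius_sq M j) ^ (2 * j)) \<le> s ^ (\<Sum>j=1..<M. 2 * j) * exp (1 / 12)"
  unfolding power_sum
proof (rule prod_perturbed_upper[where g = "\<lambda>j. M - j"])
  show "inj_on ((-) M) {1..<M}" by (auto simp: inj_on_def)
  fix j assume j: "j \<in> {1..<M}"
  then have sj: "0 < radius_sq M j" by (intro radius_sq_pos) auto
  then show "0 \<le> s ^ (2 * j)" "0 \<le> s ^ (2 * j) + (1 / radius_sq M j) ^ (2 * j)" using assms by auto
  have "(1 / radius_sq M j) ^ (2 * j) \<le> 1 / (1 + real (M - j)) ^ 4"
    using radius_sq_ratio_power[of j M M] j assms by (simp add: radius_sq_self)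
  also have "\<dots> \<le> s ^ (2 * j) * (1 / (1 + real (M - j)) ^ 4)"
    using mult_right_mono[OF one_le_power[OF assms(2), of "2 * j"], of "1 / (1 + real (M - j)) ^ 4"] by simp
  finally show "s ^ (2 * j) + (1 / radius_sq M j) ^ (2 * j) \<le> s ^ (2 * j) * (1 + 1 / (1 + real (M - j)) ^ 4)"
    by (simp add: algebra_simps)
qed auto

lemma dominant_outer_upper:
  assumes "k < M" "radius_sq M (Suc k) \<le> s"
  shows "(\<Prod>j\<in>{k<..M}. s ^ (2 * j) + radius_sq M j ^ (2 * j))
    \<le> s ^ (\<Sum>j\<in>{k<..M}. 2 * j) * (1 + (radius_sq M (Suc k) / s) ^ (2 * Suc k)) * exp (1 / 12)"
proof -
  have s: "0 < s" using radius_sq_pos[of "Suc k" M] assms by simp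
  have i: "{k<..M} = insert (Suc k) {Suc k<..M}" using assms by auto
  have "(\<Prod>j\<in>{Suc k<..M}. s ^ (2 * j) + radius_sq M j ^ (2 * j)) \<le> (\<Prod>j\<in>{Suc k<..M}. s ^ (2 * j)) * exp (1 / 12)"
  proof (rule prod_perturbed_upper[where g = "\<lambda>j. j - Suc k"])
    show "inj_on (\<lambda>j. j - Suc k) {Suc k<..M}" by (auto simp: inj_on_def)
    fix j assume j: "j \<in> {Suc k<..M}"
    then have sj: "0 < radius_sq M j" by (intro radius_sq_pos) auto
    then show "0 \<le> s ^ (2 * j)" "0 \<le> s ^ (2 * j) + radius_sq M j ^ (2 * j)" using s by auto
    have "radius_sq M j ^ (2 * j) = (radius_sq M j / radius_sq M (Suc k)) ^ (2 * j) * radius_sq M (Suc k) ^ (2 * j)"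
      using radius_sq_pos[of "Suc k" M] assms by (simp add: power_divide)
    also have "\<dots> \<le> 1 / (1 + real (j - Suc k)) ^ 4 * s ^ (2 * j)"
      using radius_sq_ratio_power'[of "Suc k" j M] radius_sq_pos[of "Suc k" M] j assms
      by (intro mult_mono power_mono) auto
    finally show "s ^ (2 * j) + radius_sq M j ^ (2 * j) \<le> s ^ (2 * j) * (1 + 1 / (1 + real (j - Suc k)) ^ 4)"
      by (simp add: algebra_simps)
  qed auto
  then have "(s ^ (2 * Suc k) + radius_sq M (Suc k) ^ (2 * Suc k)) * (\<Prod>j\<in>{Suc k<..M}. s ^ (2 * j) + radius_sq M j ^ (2 * j))
     \<le> (s ^ (2 * Suc k) + radius_sq M (Suc k) ^ (2 * Suc k)) * ((\<Prod>j\<in>{Suc k<..M}. s ^ (2 * j)) * exp (1 / 12))"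
    using s radius_sq_pos[of "Suc k" M] assms by (intro mult_left_mono) auto
  also have "\<dots> = (s ^ (2 * Suc k) * (1 + (radius_sq M (Suc k) / s) ^ (2 * Suc k))) * ((\<Prod>j\<in>{Suc k<..M}. s ^ (2 * j)) * exp (1 / 12))"
    using s by (simp add: power_divide distrib_left del: power_Suc mult_Suc_right)
  finally show ?thesis unfolding i power_sum
    by (subst (1 2) prod.insert) (simp_all only: finite_greaterThanAtMost greaterThanAtMost_iff less_irrefl simp_thms mult_ac)
qed

lemma dominant_inner_upper:
  assumes "1 \<le> k" "k \<le> M" "0 \<le> s" "s \<le> radius_sq M k"
  shows "(\<Prod>j=1..k. s ^ (2 * j) + radius_sq M j ^ (2 * j))
    \<le> (\<Prod>j=1..k. radius_sq M j ^ (2 * j)) * (1 + (s / radius_sq M k) ^ (2 * k)) * exp (1 / 12)"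
proof -
  have i: "{1..k} = insert k {1..<k}" using assms by auto
  have sk: "0 < radius_sq M k" using radius_sq_pos assms by simp
  have "(\<Prod>j\<in>{1..<k}. s ^ (2 * j) + radius_sq M j ^ (2 * j)) \<le> (\<Prod>j\<in>{1..<k}. radius_sq M j ^ (2 * j)) * exp (1 / 12)"
  proof (rule prod_perturbed_upper[where g = "\<lambda>j. k - j"])
    show "inj_on ((-) k) {1..<k}" by (auto simp: inj_on_def)
    fix j assume j: "j \<in> {1..<k}"
    then have sj: "0 < radius_sq M j" using assms by (intro radius_sq_pos) auto
    then show "0 \<le> radius_sq M j ^ (2 * j)" "0 \<le> s ^ (2 * j) + radius_sq M j ^ (2 * j)" using assms by auto
    have "s ^ (2 * j) \<le> radius_sq M k ^ (2 * j)" using assms by (intro power_mono) auto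
    also have "\<dots> = (radius_sq M k / radius_sq M j) ^ (2 * j) * radius_sq M j ^ (2 * j)"
      using sj by (simp add: power_divide)
    also have "\<dots> \<le> 1 / (1 + real (k - j)) ^ 4 * radius_sq M j ^ (2 * j)"
      using radius_sq_ratio_power[of j k M] sj j assms by (intro mult_right_mono) auto
    finally show "s ^ (2 * j) + radius_sq M j ^ (2 * j) \<le> radius_sq M j ^ (2 * j) * (1 + 1 / (1 + real (k - j)) ^ 4)"
      by (simp add: algebra_simps)
  qed auto
  then have "(s ^ (2 * k) + radius_sq M k ^ (2 * k)) * (\<Prod>j\<in>{1..<k}. s ^ (2 * j) + radius_sq M j ^ (2 * j))
     \<le> (s ^ (2 * k) + radius_sq M k ^ (2 * k)) * ((\<Prod>j\<in>{1..<k}. radius_sq M j ^ (2 * j)) * exp (1 / 12))"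
    using assms sk by (intro mult_left_mono) auto
  also have "\<dots> = (radius_sq M k ^ (2 * k) * (1 + (s / radius_sq M k) ^ (2 * k))) * ((\<Prod>j\<in>{1..<k}. radius_sq M j ^ (2 * j)) * exp (1 / 12))"
    using sk by (simp add: power_divide distrib_left)
  finally show ?thesis unfolding i
    by (subst (1 2) prod.insert) (simp_all only: finite_atLeastLessThan atLeastLessThan_iff less_irrefl simp_thms mult_ac)
qed

text \<open>
  As a function of \<open>p = s / (1 + s)\<close> the left side is a multiple of \<open>p ^ u * (1 - p) ^ v\<close> with
  \<open>u + v = n\<close>; its maximum is at \<open>p = u / n\<close>, which is Gibbs' inequality.
\<close>
lemma power_ratio_le_peak:
  assumes "k < M" "0 < s"
  shows "s ^ (2 * M\<^sup>2 - k * (k + 1)) / (1 + s) ^ (2 * M\<^sup>2) * exp (log_radius_sum M k) \<le> exp (log_peak M k)"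
proof -
  define n v u where "n = 2 * (real M)\<^sup>2" and "v = real k * (real k + 1)" and "u = n - v"
  have "k * (k + 1) \<le> M\<^sup>2" unfolding power2_eq_square using assms by (intro mult_le_mono) auto
  moreover have "0 < M\<^sup>2" using assms by simp
  ultimately have le: "k * (k + 1) < 2 * M\<^sup>2" by linarith
  then have "real (k * (k + 1)) < real (2 * M\<^sup>2)" by (simp only: of_nat_less_iff)
  then have u0: "0 < u" by (simp add: u_def n_def v_def algebra_simps)
  have v0: "0 \<le> v" by (simp add: v_def)
  have n0: "0 < n" using u0 v0 by (simp add: u_def)
  have u: "real (2 * M\<^sup>2 - k * (k + 1)) = u" using le by (simp add: of_nat_diff u_def n_def v_def algebra_simps)
  have n: "real (2 * M\<^sup>2) = n" by (simp add: n_def)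
  define p where "p = s / (1 + s)"
  have p: "0 < p" "p < 1" using assms by (auto simp: p_def)
  have lp: "ln p = ln s - ln (1 + s)" "ln (1 - p) = - ln (1 + s)"
  proof -
    show "ln p = ln s - ln (1 + s)" using assms by (simp add: p_def ln_div)
    have "1 - p = inverse (1 + s)" using assms by (simp add: p_def field_simps)
    then show "ln (1 - p) = - ln (1 + s)" using assms by (simp add: ln_inverse)
  qed
  have "u * (ln p - ln (u / n)) \<le> p * n - u"
  proof -
    have "ln (p / (u / n)) \<le> p / (u / n) - 1" using p u0 n0 by (intro ln_le_minus_one) auto
    then have "u * ln (p / (u / n)) \<le> u * (p / (u / n) - 1)" using u0 by (intro mult_left_mono) auto
    also have "\<dots> = p * n - u" using u0 n0 by (simp add: field_simps)
    also have "ln (p / (u / n)) = ln p - ln (u / n)" using p u0 n0 by (subst ln_div) auto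
    finally show ?thesis .
  qed
  moreover have "v * (ln (1 - p) - ln (v / n)) \<le> (1 - p) * n - v"
  proof (cases "v = 0")
    case True then show ?thesis using p n0 by simp
  next
    case False
    then have v1: "0 < v" using v0 by simp
    have "ln ((1 - p) / (v / n)) \<le> (1 - p) / (v / n) - 1" using p v1 n0 by (intro ln_le_minus_one) auto
    then have "v * ln ((1 - p) / (v / n)) \<le> v * ((1 - p) / (v / n) - 1)" using v1 by (intro mult_left_mono) auto
    also have "\<dots> = (1 - p) * n - v" using v1 n0 by (simp add: field_simps)
    also have "ln ((1 - p) / (v / n)) = ln (1 - p) - ln (v / n)" using p v1 n0 by (subst ln_div) auto
    finally show ?thesis .
  qed
  ultimately have "u * ln p + v * ln (1 - p) \<le> u * ln (u / n) + v * ln (v / n)"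
    by (simp add: u_def algebra_simps)
  also have "v * ln (v / n) = v * ln v - v * ln n" using v0 n0 by (cases "v = 0") (auto simp: ln_div algebra_simps)
  also have "u * ln (u / n) = u * ln u - u * ln n" using u0 n0 by (auto simp: ln_div algebra_simps)
  finally have "u * ln s - n * ln (1 + s) \<le> u * ln u + v * ln v - n * ln n"
    unfolding lp by (simp add: u_def algebra_simps)
  then have "u * ln s - n * ln (1 + s) + log_radius_sum M k \<le> log_peak M k"
    by (simp add: log_peak_def Let_def u_def v_def n_def)
  moreover have "s ^ (2 * M\<^sup>2 - k * (k + 1)) = exp (u * ln s)"
    unfolding u[symmetric] using assms by (simp add: exp_of_nat_mult)
  moreover have "(1 + s) ^ (2 * M\<^sup>2) = exp (n * ln (1 + s))"
    unfolding n[symmetric] using assms by (simp only: exp_of_nat_mult) (simp add: exp_ln)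
  ultimately show ?thesis by (simp add: exp_diff[symmetric] exp_add[symmetric])
qed

text \<open>
  Only the two circles that bound the band contribute a factor \<open>1 + X\<close>, \<open>1 + Y\<close> that is not close to 1.
  They are not both close to 2: the product \<open>X Y\<close> is at most the power \<open>2 k\<close> of the quotient of the two squared
  radii, which is at most \<open>1 / 16\<close>.
\<close>
lemma dominant_band:
  assumes "1 \<le> k" "k < M" "radius_sq M (Suc k) \<le> s" "s \<le> radius_sq M k"
  shows "dominant M s / (1 + s) ^ (2 * M\<^sup>2) \<le> 17 / 8 * exp (1 / 4) * exp (log_peak M k)"
proof -
  have s1: "1 \<le> s" using radius_sq_ge_1[of "Suc k" M] assms by simp
  have k0: "0 < radius_sq M k" "0 < radius_sq M (Suc k)" using radius_sq_pos assms by auto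
  define X Y where "X = (s / radius_sq M k) ^ (2 * k)" and "Y = (radius_sq M (Suc k) / s) ^ (2 * Suc k)"
  have X: "0 \<le> X" "X \<le> 1" using s1 k0 assms by (auto simp: X_def intro!: power_le_one simp: divide_le_eq_1)
  have Y: "0 \<le> Y" "Y \<le> 1" unfolding Y_def using s1 k0 assms by (auto intro!: power_le_one simp: divide_le_eq_1 simp del: power_Suc mult_Suc_right)
  have "Y \<le> (radius_sq M (Suc k) / s) ^ (2 * k)"
    unfolding Y_def using s1 k0 assms by (intro power_decreasing) (auto simp: divide_le_eq_1)
  then have "X * Y \<le> (s / radius_sq M k) ^ (2 * k) * (radius_sq M (Suc k) / s) ^ (2 * k)"
    unfolding X_def using s1 k0 by (intro mult_left_mono) auto
  also have "\<dots> = (radius_sq M (Suc k) / radius_sq M k) ^ (2 * k)"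
    using s1 k0 by (simp add: power_mult_distrib[symmetric])
  also have "\<dots> \<le> 1 / (1 + real (Suc k - k)) ^ 4" using assms by (intro radius_sq_ratio_power) auto
  finally have XY: "X * Y \<le> 1 / 16" by simp
  \<comment> \<open>\<open>X\<close> and \<open>Y\<close> lie in \<open>[0, 1]\<close>, so \<open>X + Y \<le> 1 + X Y\<close>.\<close>
  have "0 \<le> (1 - X) * (1 - Y)" using X Y by (intro mult_nonneg_nonneg) auto
  then have B: "(1 + X) * (1 + Y) \<le> 17 / 8" using XY by (simp add: algebra_simps)
  have split: "(\<Prod>j=1..M. s ^ (2 * j) + radius_sq M j ^ (2 * j))
    = (\<Prod>j=1..k. s ^ (2 * j) + radius_sq M j ^ (2 * j)) * (\<Prod>j\<in>{k<..M}. s ^ (2 * j) + radius_sq M j ^ (2 * j))"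
  proof -
    have "{1..M} = {1..k} \<union> {k<..M}" using assms by auto
    then show ?thesis by (simp add: prod.union_disjoint ivl_disj_int)
  qed
  have pos: "0 \<le> (\<Prod>j\<in>S. s ^ (2 * j) + radius_sq M j ^ (2 * j))" if "S \<subseteq> {1..M}" for S
    using that s1 radius_sq_pos[of _ M] by (intro prod_nonneg add_nonneg_nonneg zero_le_power) (auto simp: subset_iff intro: less_imp_le)
  have pos_south: "0 \<le> (\<Prod>j = 1..<M. s ^ (2 * j) + (1 / radius_sq M j) ^ (2 * j))"
    using s1 radius_sq_pos[of _ M] by (intro prod_nonneg add_nonneg_nonneg zero_le_power) (auto intro: less_imp_le)
  have pos_inner: "0 \<le> (\<Prod>j = 1..k. radius_sq M j ^ (2 * j))"
    using assms by (intro prod_nonneg zero_le_power radius_sq_pos[THEN less_imp_le]) auto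
  have "dominant M s \<le> ((\<Prod>j=1..k. radius_sq M j ^ (2 * j)) * (1 + X) * exp (1 / 12)
     * (s ^ (\<Sum>j\<in>{k<..M}. 2 * j) * (1 + Y) * exp (1 / 12))) * (s ^ (\<Sum>j=1..<M. 2 * j) * exp (1 / 12))"
    unfolding dominant_def split X_def Y_def
    by (intro mult_mono dominant_south_upper dominant_outer_upper dominant_inner_upper mult_nonneg_nonneg pos pos_south pos_inner)
      (use assms s1 k0 in auto)
  also have "\<dots> = exp (1 / 12) * exp (1 / 12) * exp (1 / 12) * ((1 + X) * (1 + Y))
     * (exp (log_radius_sum M k) * s ^ ((\<Sum>j\<in>{k<..M}. 2 * j) + (\<Sum>j=1..<M. 2 * j)))"
    using prod_radius_sq_eq_exp[of k M] assms by (simp add: power_add mult_ac)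
  also have "exp (1 / 12) * exp (1 / 12) * exp (1 / 12) = exp (1 / 4 :: real)"
    by (simp add: exp_add[symmetric])
  also have "(\<Sum>j\<in>{k<..M}. 2 * j) + (\<Sum>j=1..<M. 2 * j) = 2 * M\<^sup>2 - k * (k + 1)"
    using assms by (intro exponents_total) auto
  also have "exp (1 / 4) * ((1 + X) * (1 + Y)) * (exp (log_radius_sum M k) * s ^ (2 * M\<^sup>2 - k * (k + 1)))
     \<le> exp (1 / 4) * (17 / 8) * (exp (log_radius_sum M k) * s ^ (2 * M\<^sup>2 - k * (k + 1)))"
    using B s1 by (intro mult_left_mono mult_right_mono) auto
  finally have "dominant M s / (1 + s) ^ (2 * M\<^sup>2) \<le> exp (1 / 4) * (17 / 8) * (exp (log_radius_sum M k) * s ^ (2 * M\<^sup>2 - k * (k + 1))) / (1 + s) ^ (2 * M\<^sup>2)"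
    using s1 by (intro divide_right_mono) auto
  also have "\<dots> = 17 / 8 * exp (1 / 4) * (s ^ (2 * M\<^sup>2 - k * (k + 1)) / (1 + s) ^ (2 * M\<^sup>2) * exp (log_radius_sum M k))"
    by simp
  also have "\<dots> \<le> 17 / 8 * exp (1 / 4) * exp (log_peak M k)"
    using power_ratio_le_peak[of k M s] assms s1 by (intro mult_left_mono) auto
  finally show ?thesis .
qed

text \<open>
  In the cap the only nearby circle is the first one. With \<open>w = n / (1 + s) \<le> 1\<close> its factor is at most
  \<open>1 + w\<^sup>2 \<le> exp w\<close>, and this is absorbed by the decay of \<open>(s / (1 + s)) ^ n\<close>.
\<close>
lemma dominant_cap:
  assumes "1 \<le> M" "radius_sq M 1 \<le> s"
  shows "dominant M s / (1 + s) ^ (2 * M\<^sup>2) \<le> exp (1 / 4)"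
proof -
  define n where "n = 2 * (real M)\<^sup>2"
  have n: "real (2 * M\<^sup>2) = n" by (simp add: n_def)
  have "1\<^sup>2 \<le> (real M)\<^sup>2" using assms by (intro power_mono) auto
  then have n1: "2 \<le> n" by (simp add: n_def)
  have sn: "radius_sq M 1 = n - 1" by (simp add: radius_sq_def n_def)
  have s1: "1 \<le> s" using radius_sq_ge_1[of 1 M] assms by simp
  define Y where "Y = (radius_sq M 1 / s) ^ (2 * 1)"
  have nn: "0 \<le> (\<Prod>j = 1..<M. s ^ (2 * j) + (1 / radius_sq M j) ^ (2 * j))"
    using s1 radius_sq_pos[of _ M] by (intro prod_nonneg add_nonneg_nonneg zero_le_power) (auto intro: less_imp_le)
  have "{1..M} = {0<..M}" by auto
  then have "dominant M s \<le> (s ^ (\<Sum>j\<in>{0<..M}. 2 * j) * (1 + Y) * exp (1 / 12)) * (s ^ (\<Sum>j=1..<M. 2 * j) * exp (1 / 12))"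
    using dominant_outer_upper[of 0 M s] dominant_south_upper[of M s] nn assms s1
    unfolding dominant_def Y_def by (intro mult_mono) (auto simp: One_nat_def)
  also have "\<dots> = exp (1 / 12) * exp (1 / 12) * ((1 + Y) * s ^ ((\<Sum>j\<in>{0<..M}. 2 * j) + (\<Sum>j=1..<M. 2 * j)))"
    by (simp add: power_add mult_ac)
  also have "(\<Sum>j\<in>{0<..M}. 2 * j) + (\<Sum>j=1..<M. 2 * j) = 2 * M\<^sup>2"
    using exponents_total[of 0 M] by simp
  also have "exp (1 / 12) * exp (1 / 12) * ((1 + Y) * s ^ (2 * M\<^sup>2)) \<le> exp (1 / 4) * (1 + s) ^ (2 * M\<^sup>2)"
  proof (rule mult_mono)
    show "exp (1 / 12) * exp (1 / 12) \<le> exp (1 / 4 :: real)" by (simp add: exp_add[symmetric])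
    define w where "w = n / (1 + s)"
    have w: "0 < w" "w \<le> 1" using s1 n1 assms sn by (auto simp: w_def divide_simps)
    have sw: "s = n / w - 1" using s1 n1 by (simp add: w_def)
    have "(n - 1) / s \<le> w"
    proof -
      have "(n - 1) * (1 + s) \<le> n * s" using assms(2) sn by (simp add: algebra_simps)
      then show ?thesis using s1 by (simp add: w_def divide_simps mult.commute)
    qed
    then have "Y \<le> w\<^sup>2" unfolding Y_def sn mult_1_right using s1 n1 by (intro power_mono) auto
    moreover have "w\<^sup>2 \<le> w" using w by (simp add: power2_eq_square mult_left_le)
    moreover have "1 + w + w\<^sup>2 / 2 \<le> exp w" using exp_lower_Taylor_quadratic[of w] w by simp
    ultimately have "1 + Y \<le> exp w" using w(1) by linarith
    also have "exp w = (exp (1 / (1 + s))) ^ (2 * M\<^sup>2)"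
      unfolding exp_of_nat_mult[symmetric] n by (simp add: w_def)
    also have "\<dots> \<le> ((1 + s) / s) ^ (2 * M\<^sup>2)"
    proof (rule power_mono)
      have "1 - 1 / (1 + s) \<le> exp (- (1 / (1 + s)))" using exp_ge_add_one_self[of "- (1 / (1 + s))"] by simp
      moreover have "1 - 1 / (1 + s) = s / (1 + s)" using s1 by (simp add: field_simps)
      ultimately have "inverse (exp (- (1 / (1 + s)))) \<le> inverse (s / (1 + s))" using s1 by (intro le_imp_inverse_le) auto
      then show "exp (1 / (1 + s)) \<le> (1 + s) / s" by (simp add: exp_minus[symmetric])
    qed simp
    finally show "(1 + Y) * s ^ (2 * M\<^sup>2) \<le> (1 + s) ^ (2 * M\<^sup>2)"
      using s1 by (simp add: power_divide divide_simps)
    show "0 \<le> (1 + Y) * s ^ (2 * M\<^sup>2)" using s1 by (simp add: Y_def)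
  qed simp
  finally show ?thesis using s1 by (simp add: pos_divide_le_eq)
qed

section \<open>The Bombieri--Weyl norm as an integral\<close>

lemma exp_1_power_le: "exp (real n) \<le> (272 / 100) ^ n"
proof -
  have "exp (real n) = exp 1 ^ n" by (simp add: exp_of_nat_mult[symmetric])
  also have "\<dots> \<le> (272 / 100) ^ n" using e_less_272 by (intro power_mono) auto
  finally show ?thesis .
qed

text \<open>
  The growth law of the peaks, translated from the band number to the position on the sphere: in band
  \<open>k\<close> one has \<open>M / (k + 1) \<le> \<surd>((1 + s) / 2)\<close>.
\<close>
lemma dominant_bound:
  assumes "2 \<le> M" "1 \<le> s"
  shows "(dominant M s / (1 + s) ^ (2 * M\<^sup>2))\<^sup>2 \<le> (17 / 8)\<^sup>2 * exp (8 / 3) * (circle_value M M)\<^sup>2 * sqrt ((1 + s) / 2)"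
proof -
  \<comment> \<open>The point lies between circles \<open>k + 1\<close> and \<open>k\<close>; \<open>k = 0\<close> is the polar cap.\<close>
  define k where "k = (LEAST k. radius_sq M (Suc k) \<le> s)"
  have ex: "radius_sq M (Suc (M - 1)) \<le> s" using assms by (simp add: radius_sq_self)
  have lo: "radius_sq M (Suc k) \<le> s" unfolding k_def by (rule LeastI[of "\<lambda>k. radius_sq M (Suc k) \<le> s", OF ex])
  have "k \<le> M - 1" unfolding k_def by (rule Least_le[of "\<lambda>k. radius_sq M (Suc k) \<le> s", OF ex])
  then have kM: "k < M" using assms by auto
  define K where "K = circle_value M M"
  have K: "0 < K" unfolding K_def using assms by (intro circle_value_pos) auto
  define F where "F = dominant M s / (1 + s) ^ (2 * M\<^sup>2)"
  have F0: "0 \<le> F" unfolding F_def dominant_def using assms radius_sq_pos[of _ M]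
    by (intro divide_nonneg_nonneg mult_nonneg_nonneg prod_nonneg add_nonneg_nonneg zero_le_power) (auto intro: less_imp_le)
  define G where "G = K\<^sup>2 * exp (13 / 6) * (real M / (real k + 1))"
  have G: "0 \<le> G" by (simp add: G_def)
  have e: "exp (1 / 4) ^ 2 = exp (1 / 2 :: real)" by (simp add: exp_double[symmetric])
  have "F\<^sup>2 \<le> (17 / 8)\<^sup>2 * exp (1 / 2) * G"
  proof (cases "k = 0")
    case True
    have "exp (5 * ln 2 - 4) \<le> exp (2 * ln K + ln (real M) + 13 / 6)"
      using log_peak_cap[OF assms(1)] by (simp add: K_def)
    moreover have "exp (5 * ln 2 - 4 :: real) = 32 / exp 4"
    proof -
      have "exp (5 * ln 2 :: real) = exp (ln 2) ^ 5" by (subst exp_of_nat_mult[symmetric]) simp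
      then show ?thesis by (simp add: exp_diff)
    qed
    moreover have "exp (2 * ln K + ln (real M) + 13 / 6) = G"
      using K assms True by (simp add: G_def exp_add exp_double)
    ultimately have "32 / exp 4 \<le> G" by simp
    then have g: "32 \<le> G * exp 4" by (simp add: divide_le_eq)
    have "exp (real 4) \<le> 144" using exp_1_power_le[of 4] by (simp add: power_numeral_reduce)
    then have "G * exp 4 \<le> G * 144" using G by (intro mult_left_mono) auto
    then have "1 \<le> (17 / 8)\<^sup>2 * G" using g by (simp add: power2_eq_square)
    have "F \<le> exp (1 / 4)" unfolding F_def using dominant_cap[of M s] lo True assms by simp
    then have "F\<^sup>2 \<le> exp (1 / 4) ^ 2" using F0 by (intro power_mono)
    also have "\<dots> = 1 * exp (1 / 2)" by (simp add: e)
    also have "\<dots> \<le> ((17 / 8)\<^sup>2 * G) * exp (1 / 2)"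
      using \<open>1 \<le> (17 / 8)\<^sup>2 * G\<close> by (rule mult_right_mono) simp
    finally show ?thesis by (simp add: mult_ac)
  next
    case False
    then have "\<not> radius_sq M (Suc (k - 1)) \<le> s" using not_less_Least[of "k - 1" "\<lambda>k. radius_sq M (Suc k) \<le> s"]
      by (simp add: k_def)
    then have hi: "s \<le> radius_sq M k" using False by simp
    have "exp (2 * log_peak M k + ln (real k + 1)) \<le> exp (2 * ln K + ln (real M) + 13 / 6)"
      using log_peak_bound[of k M] False kM by (simp add: K_def)
    then have "exp (2 * log_peak M k) * (real k + 1) \<le> K\<^sup>2 * real M * exp (13 / 6)"
      using K assms by (simp add: exp_add exp_double)
    then have p: "exp (log_peak M k) ^ 2 \<le> G"
      by (simp add: G_def exp_double[symmetric] pos_le_divide_eq mult_ac)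
    have "F \<le> 17 / 8 * exp (1 / 4) * exp (log_peak M k)"
      unfolding F_def using False kM lo hi by (intro dominant_band) auto
    then have "F\<^sup>2 \<le> (17 / 8 * exp (1 / 4) * exp (log_peak M k))\<^sup>2" using F0 by (intro power_mono)
    also have "\<dots> = (17 / 8)\<^sup>2 * exp (1 / 2) * exp (log_peak M k) ^ 2" by (simp only: power_mult_distrib e)
    also have "\<dots> \<le> (17 / 8)\<^sup>2 * exp (1 / 2) * G" using p by (intro mult_left_mono) auto
    finally show ?thesis .
  qed
  also have "G \<le> K\<^sup>2 * exp (13 / 6) * sqrt ((1 + s) / 2)"
  proof -
    have "(real M / (real k + 1))\<^sup>2 = (1 + radius_sq M (Suc k)) / 2"
      by (subst one_plus_radius_sq) (auto simp: power_divide add.commute)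
    also have "\<dots> \<le> (1 + s) / 2" using lo by simp
    finally have "real M / (real k + 1) \<le> sqrt ((1 + s) / 2)" by (rule real_le_rsqrt)
    then show ?thesis unfolding G_def by (intro mult_left_mono) auto
  qed
  then have "(17 / 8)\<^sup>2 * exp (1 / 2) * G \<le> (17 / 8)\<^sup>2 * exp (1 / 2) * (K\<^sup>2 * exp (13 / 6) * sqrt ((1 + s) / 2))"
    by (intro mult_left_mono) auto
  also have "\<dots> = (17 / 8)\<^sup>2 * exp (1 / 2 + 13 / 6) * K\<^sup>2 * sqrt ((1 + s) / 2)"
    by (simp only: exp_add mult_ac)
  finally show ?thesis by (simp add: F_def K_def)
qed

text \<open>
  Exchanging the hemispheres inverts the radii, under which the set of all radii is invariant.
\<close>
lemma dominant_inverse: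
  assumes "1 \<le> M" "0 < s"
  shows "dominant M (1 / s) / (1 + 1 / s) ^ (2 * M\<^sup>2) = dominant M s / (1 + s) ^ (2 * M\<^sup>2)"
proof -
  have split: "(\<Prod>j=1..M. h j) = h M * (\<Prod>j=1..<M. h j)" for h :: "nat \<Rightarrow> real"
  proof -
    have "{1..M} = insert M {1..<M}" using assms by auto
    then show ?thesis by simp
  qed
  have E: "2 * M\<^sup>2 = 2 * M + ((\<Sum>j=1..<M. 2 * j) + (\<Sum>j=1..<M. 2 * j))"
  proof -
    have "{0<..M} = insert M {1..<M}" using assms by auto
    then show ?thesis using exponents_total[of 0 M] by simp
  qed
  have fac: "((1 / s) ^ (2 * j) + c ^ (2 * j)) = c ^ (2 * j) * (s ^ (2 * j) + (1 / c) ^ (2 * j)) / s ^ (2 * j)"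
    if "0 < c" for c j using that assms by (simp add: power_divide field_simps)
  have D: "dominant M t = (t ^ (2 * M) + 1) *
      ((\<Prod>j=1..<M. t ^ (2 * j) + radius_sq M j ^ (2 * j)) * (\<Prod>j=1..<M. t ^ (2 * j) + (1 / radius_sq M j) ^ (2 * j)))" for t
    unfolding dominant_def split radius_sq_self[OF assms(1)] by (simp only: power_one mult.assoc)
  have "dominant M (1 / s) = ((1 / s) ^ (2 * M) + 1) *
      ((\<Prod>j=1..<M. (1 / s) ^ (2 * j) + radius_sq M j ^ (2 * j)) * (\<Prod>j=1..<M. (1 / s) ^ (2 * j) + (1 / radius_sq M j) ^ (2 * j)))"
    by (rule D)
  also have "(\<Prod>j=1..<M. (1 / s) ^ (2 * j) + radius_sq M j ^ (2 * j)) * (\<Prod>j=1..<M. (1 / s) ^ (2 * j) + (1 / radius_sq M j) ^ (2 * j))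
     = (\<Prod>j=1..<M. (s ^ (2 * j) + radius_sq M j ^ (2 * j)) * (s ^ (2 * j) + (1 / radius_sq M j) ^ (2 * j)) / (s ^ (2 * j) * s ^ (2 * j)))"
    unfolding prod.distrib[symmetric]
  proof (rule prod.cong[OF refl])
    fix j assume "j \<in> {1..<M}"
    then have c: "0 < radius_sq M j" by (intro radius_sq_pos) auto
    show "((1 / s) ^ (2 * j) + radius_sq M j ^ (2 * j)) * ((1 / s) ^ (2 * j) + (1 / radius_sq M j) ^ (2 * j))
      = (s ^ (2 * j) + radius_sq M j ^ (2 * j)) * (s ^ (2 * j) + (1 / radius_sq M j) ^ (2 * j)) / (s ^ (2 * j) * s ^ (2 * j))"
      using fac[of "radius_sq M j" j] fac[of "1 / radius_sq M j" j] c by (simp add: power_divide)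
  qed
  also have "\<dots> = (\<Prod>j=1..<M. (s ^ (2 * j) + radius_sq M j ^ (2 * j))) * (\<Prod>j=1..<M. s ^ (2 * j) + (1 / radius_sq M j) ^ (2 * j))
      / (s ^ (\<Sum>j=1..<M. 2 * j) * s ^ (\<Sum>j=1..<M. 2 * j))"
    by (simp add: prod_dividef prod.distrib power_sum)
  also have "(1 / s) ^ (2 * M) + 1 = (s ^ (2 * M) + 1) / s ^ (2 * M)"
    using assms by (simp add: power_divide field_simps)
  finally have "dominant M (1 / s) = dominant M s / s ^ (2 * M\<^sup>2)"
    unfolding E power_add D[of s] by (simp only: times_divide_times_eq)
  moreover have "1 + 1 / s = (1 + s) / s" using assms by (simp add: field_simps)
  then have "(1 + 1 / s) ^ (2 * M\<^sup>2) = (1 + s) ^ (2 * M\<^sup>2) / s ^ (2 * M\<^sup>2)"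
    by (simp only: power_divide)
  ultimately show ?thesis using assms by simp
qed

text \<open>
  A value of the Beta function. Through it the weights \<open>1 / (N choose i)\<close> of the Bombieri--Weyl norm become
  an integral over the height on the sphere.
\<close>
lemma has_integral_Bernstein:
  assumes "i \<le> N"
  shows "((\<lambda>p::real. p ^ i * (1 - p) ^ (N - i)) has_integral 1 / (real (N + 1) * real (N choose i))) {0..1}"
proof -
  have B: "((\<lambda>t. t powr ((1 + real i) - 1) * (1 - t) powr ((1 + real (N - i)) - 1)) has_integral
      Beta (1 + real i) (1 + real (N - i))) {0..1}"
    by (rule has_integral_Beta_real) auto
  have "Beta (1 + real i) (1 + real (N - i)) = fact i * fact (N - i) / fact (N + 1)"
  proof -
    have "1 + real i + (1 + real (N - i)) = 1 + real (N + 1)" using assms by (simp add: of_nat_diff)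
    then show ?thesis unfolding Beta_def by (simp only: Gamma_fact)
  qed
  also have "\<dots> = 1 / (real (N + 1) * real (N choose i))"
    using assms by (simp add: binomial_fact field_simps)
  finally have e: "Beta (1 + real i) (1 + real (N - i)) = 1 / (real (N + 1) * real (N choose i))" .
  \<comment> \<open>At the endpoints \<open>powr\<close> differs from the power: \<open>0 powr 0 = 0\<close>.\<close>
  show ?thesis
    by (rule has_integral_spike_finite[of "{0, 1}", OF _ _ B[unfolded e]]) (auto simp: powr_realpow)
qed

text \<open>
  For majorants that are singular at an endpoint, where division by zero gives them the value 0.
\<close>
lemma integral_le_off_finite:
  fixes f g :: "real \<Rightarrow> real"
  assumes "finite T" "f integrable_on S" "(g has_integral J) S" "\<And>x. x \<in> S - T \<Longrightarrow> f x \<le> g x"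
  shows "integral S f \<le> J"
proof -
  have "((\<lambda>x. if x \<in> T then f x else g x) has_integral J) S"
    by (rule has_integral_spike_finite[OF assms(1) _ assms(3)]) auto
  then show ?thesis using assms(2,4)
    by (intro has_integral_le[OF integrable_integral]) auto
qed

lemma has_integral_inverse_sqrt:
  "((\<lambda>p::real. 1 / sqrt (2 * p)) has_integral 1) {0..1 / 2}"
  "((\<lambda>p::real. 1 / sqrt (2 * (1 - p))) has_integral 1) {1 / 2..1}"
proof -
  have "((\<lambda>p::real. 1 / sqrt (2 * p)) has_integral (sqrt (2 * (1 / 2)) - sqrt (2 * 0))) {0..1 / 2}"
    by (rule fundamental_theorem_of_calculus_interior)
      (auto intro!: continuous_intros derivative_eq_intros simp: has_real_derivative_iff_has_vector_derivative[symmetric] divide_simps)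
  then show "((\<lambda>p::real. 1 / sqrt (2 * p)) has_integral 1) {0..1 / 2}" by simp
  have "((\<lambda>p::real. 1 / sqrt (2 * (1 - p))) has_integral (- sqrt (2 * (1 - 1)) - (- sqrt (2 * (1 - 1 / 2))))) {1 / 2..1}"
    by (rule fundamental_theorem_of_calculus_interior)
      (auto intro!: continuous_intros derivative_eq_intros simp: has_real_derivative_iff_has_vector_derivative[symmetric] divide_simps)
  then show "((\<lambda>p::real. 1 / sqrt (2 * (1 - p))) has_integral 1) {1 / 2..1}" by simp
qed

lemma sum_squares_le_square_sum:
  fixes b :: "nat \<Rightarrow> real"
  assumes "\<And>i. i \<in> A \<Longrightarrow> 0 \<le> b i" "finite A"
  shows "(\<Sum>i\<in>A. (b i)\<^sup>2) \<le> (\<Sum>i\<in>A. b i)\<^sup>2"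
proof -
  have "(\<Sum>i\<in>A. (b i)\<^sup>2) \<le> (\<Sum>i\<in>A. b i * sum b A)"
    unfolding power2_eq_square using assms by (intro sum_mono mult_left_mono member_le_sum) auto
  then show ?thesis by (simp add: power2_eq_square sum_distrib_right)
qed

text \<open>
  With \<open>p = s / (1 + s)\<close> the squared norm is \<open>N + 1\<close> times the integral over \<open>p\<close> of
  \<open>\<Sum> |a i|\<^sup>2 s ^ i / (1 + s) ^ N\<close>. Bounding the sum of squares by the square of the sum loses only a
  constant, since few terms dominate for a given \<open>s\<close>. The resulting majorant is a multiple of
  \<open>1 / \<surd>(2 (1 - p))\<close> on the northern hemisphere and of \<open>1 / \<surd>(2 p)\<close> on the southern one, each of integral 1.
\<close>
lemma bombieri_norm_le_dominant:
  assumes M: "2 \<le> M" and le: "\<And>x. 0 < x \<Longrightarrow> (\<Sum>i\<le>4 * M\<^sup>2. cmod (a i) * x ^ i) \<le> dominant M (x\<^sup>2)"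
  shows "(bombieri_norm (4 * M\<^sup>2) a)\<^sup>2
     \<le> (real (4 * M\<^sup>2) + 1) * (2 * ((17 / 8)\<^sup>2 * exp (8 / 3) * (circle_value M M)\<^sup>2))"
proof -
  define N where "N = 4 * M\<^sup>2"
  define C where "C = (17 / 8)\<^sup>2 * exp (8 / 3) * (circle_value M M)\<^sup>2"
  define \<Phi> where "\<Phi> p = (\<Sum>i\<le>N. (cmod (a i))\<^sup>2 * (p ^ i * (1 - p) ^ (N - i)))" for p :: real
  have "(\<Phi> has_integral (\<Sum>i\<le>N. (cmod (a i))\<^sup>2 * (1 / (real (N + 1) * real (N choose i))))) {0..1}"
    unfolding \<Phi>_def by (intro has_integral_sum has_integral_mult_right has_integral_Bernstein) auto
  also have "(\<Sum>i\<le>N. (cmod (a i))\<^sup>2 * (1 / (real (N + 1) * real (N choose i)))) = (bombieri_norm N a)\<^sup>2 / (real N + 1)"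
    unfolding bombieri_norm_def by (simp add: sum_nonneg sum_divide_distrib mult.commute add.commute)
  finally have I: "(\<Phi> has_integral (bombieri_norm N a)\<^sup>2 / (real N + 1)) {0..1}" .
  have bound: "\<Phi> p \<le> (dominant M (p / (1 - p)) / (1 + p / (1 - p)) ^ (2 * M\<^sup>2))\<^sup>2" if p: "0 < p" "p < 1" for p
  proof -
    define s x where "s = p / (1 - p)" and "x = sqrt s"
    have s: "0 < s" using p by (simp add: s_def)
    have x: "0 < x" "x\<^sup>2 = s" using s by (simp_all add: x_def)
    have q: "1 - p = 1 / (1 + s)" using p by (simp add: s_def field_simps)
    then have ps: "p = s * (1 / (1 + s))" using p unfolding q[symmetric] by (simp add: s_def)
    have "\<Phi> p = (\<Sum>i\<le>N. (cmod (a i) * x ^ i / (1 + s) ^ (2 * M\<^sup>2))\<^sup>2)"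
      unfolding \<Phi>_def
    proof (rule sum.cong[OF refl])
      fix i assume i: "i \<in> {..N}"
      have "p ^ i * (1 - p) ^ (N - i) = s ^ i * (1 / (1 + s)) ^ i * (1 / (1 + s)) ^ (N - i)"
        unfolding q by (subst ps) (simp only: power_mult_distrib)
      also have "\<dots> = s ^ i * (1 / (1 + s)) ^ N"
        using i by (simp add: mult.assoc power_add[symmetric])
      also have "\<dots> = (x ^ i / (1 + s) ^ (2 * M\<^sup>2))\<^sup>2"
        unfolding x(2)[symmetric] N_def by (simp add: power_divide power_mult[symmetric] mult.commute)
      finally show "(cmod (a i))\<^sup>2 * (p ^ i * (1 - p) ^ (N - i)) = (cmod (a i) * x ^ i / (1 + s) ^ (2 * M\<^sup>2))\<^sup>2"
        by (simp add: power_mult_distrib power_divide)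
    qed
    also have "\<dots> \<le> (\<Sum>i\<le>N. cmod (a i) * x ^ i / (1 + s) ^ (2 * M\<^sup>2))\<^sup>2"
      using x s by (intro sum_squares_le_square_sum) auto
    also have "\<dots> \<le> (dominant M s / (1 + s) ^ (2 * M\<^sup>2))\<^sup>2"
      unfolding sum_divide_distrib[symmetric]
      using le[OF x(1)] x s by (intro power_mono divide_right_mono divide_nonneg_nonneg sum_nonneg) (auto simp: N_def)
    finally show ?thesis by (simp add: s_def)
  qed
  have high: "\<Phi> p \<le> C * (1 / sqrt (2 * (1 - p)))" if p: "1 / 2 \<le> p" "p < 1" for p
  proof -
    have s: "1 \<le> p / (1 - p)" using p by (simp add: divide_simps)
    have e: "(1 + p / (1 - p)) / 2 = 1 / (2 * (1 - p))" using p by (simp add: field_simps)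
    show ?thesis using bound[of p] dominant_bound[OF M s] p unfolding e C_def by (simp add: real_sqrt_divide)
  qed
  have low: "\<Phi> p \<le> C * (1 / sqrt (2 * p))" if p: "0 < p" "p \<le> 1 / 2" for p
  proof -
    have s: "1 \<le> (1 - p) / p" using p by (simp add: divide_simps)
    have i: "p / (1 - p) = 1 / ((1 - p) / p)" by simp
    have e: "(1 + (1 - p) / p) / 2 = 1 / (2 * p)" using p by (simp add: field_simps)
    have "\<Phi> p \<le> (dominant M ((1 - p) / p) / (1 + (1 - p) / p) ^ (2 * M\<^sup>2))\<^sup>2"
      using bound[of p] dominant_inverse[of M "(1 - p) / p"] M p unfolding i by simp
    then show ?thesis using dominant_bound[OF M s] p unfolding e C_def by (simp add: real_sqrt_divide)
  qed
  have int: "\<Phi> integrable_on {0..1}" using I by blast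
  have "(bombieri_norm N a)\<^sup>2 / (real N + 1) = integral {0..1} \<Phi>" using I by (simp add: integral_unique)
  also have "\<dots> = integral {0..1 / 2} \<Phi> + integral {1 / 2..1} \<Phi>"
    using int by (intro Henstock_Kurzweil_Integration.integral_combine[symmetric]) auto
  also have "\<dots> \<le> C * 1 + C * 1"
  proof (rule add_mono)
    show "integral {0..1 / 2} \<Phi> \<le> C * 1"
      using int low by (intro integral_le_off_finite[of "{0}", OF _ _ has_integral_mult_right[OF has_integral_inverse_sqrt(1)]])
        (auto intro: integrable_on_subinterval)
    show "integral {1 / 2..1} \<Phi> \<le> C * 1"
      using int high by (intro integral_le_off_finite[of "{1}", OF _ _ has_integral_mult_right[OF has_integral_inverse_sqrt(2)]])
        (auto intro: integrable_on_subinterval)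
  qed
  also have "\<dots> = 2 * C" by simp
  finally have "(bombieri_norm N a)\<^sup>2 \<le> 2 * C * (real N + 1)" by (subst (asm) pos_divide_le_eq) auto
  then show ?thesis unfolding N_def C_def by (simp only: mult.commute)
qed

section \<open>The condition number at a simple zero\<close>

text \<open>
  Euler's identity: at a zero, \<open>z h\<^sub>x + h\<^sub>y = N h = 0\<close>, so the partial derivative in the second variable
  is \<open>- z f'(z)\<close>.
\<close>
lemma hom_poly_has_derivative:
  fixes f :: "complex poly"
  assumes "poly f z = 0"
  shows "(hom_poly (degree f) (coeff f) has_derivative
    (\<lambda>w. (fst w - z * snd w) * poly (pderiv f) z)) (at (z, 1))"
proof -
  let ?N = "degree f"
  have "((\<lambda>p. \<Sum>i\<le>?N. coeff f i * fst p ^ i * snd p ^ (?N - i)) has_derivative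
     (\<lambda>w. \<Sum>i\<le>?N. coeff f i * (of_nat i * z ^ (i - 1) * fst w + of_nat (?N - i) * z ^ i * snd w))) (at (z, 1))"
    by (auto intro!: derivative_eq_intros simp: algebra_simps)
  moreover have "(\<lambda>p. \<Sum>i\<le>?N. coeff f i * fst p ^ i * snd p ^ (?N - i)) = hom_poly ?N (coeff f)"
    by (auto simp: hom_poly_def fun_eq_iff)
  moreover have "(\<lambda>w. \<Sum>i\<le>?N. coeff f i * (of_nat i * z ^ (i - 1) * fst w + of_nat (?N - i) * z ^ i * snd w))
     = (\<lambda>w. (fst w - z * snd w) * poly (pderiv f) z)"
  proof
    fix w :: "complex \<times> complex"
    have d: "poly (pderiv f) z = (\<Sum>i\<le>?N. coeff f i * (of_nat i * z ^ (i - 1)))"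
    proof -
      have "((\<lambda>z. \<Sum>i\<le>?N. coeff f i * z ^ i) has_field_derivative
          (\<Sum>i\<le>?N. coeff f i * (of_nat i * z ^ (i - 1)))) (at z)"
        by (auto intro!: derivative_eq_intros sum.cong simp: mult_ac)
      then have "(poly f has_field_derivative (\<Sum>i\<le>?N. coeff f i * (of_nat i * z ^ (i - 1)))) (at z)"
        by (simp add: poly_altdef[abs_def])
      then show ?thesis using DERIV_unique[OF poly_DERIV] by blast
    qed
    have "(\<Sum>i\<le>?N. coeff f i * (of_nat i * z ^ (i - 1) * fst w + of_nat (?N - i) * z ^ i * snd w))
      = (\<Sum>i\<le>?N. (fst w - z * snd w) * (coeff f i * (of_nat i * z ^ (i - 1))) + of_nat ?N * snd w * (coeff f i * z ^ i))"
    proof (rule sum.cong[OF refl])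
      fix i assume "i \<in> {..?N}"
      then show "coeff f i * (of_nat i * z ^ (i - 1) * fst w + of_nat (?N - i) * z ^ i * snd w)
       = (fst w - z * snd w) * (coeff f i * (of_nat i * z ^ (i - 1))) + of_nat ?N * snd w * (coeff f i * z ^ i)"
        by (cases i) (auto simp: of_nat_diff algebra_simps)
    qed
    also have "\<dots> = (fst w - z * snd w) * poly (pderiv f) z + of_nat ?N * snd w * poly f z"
      by (simp add: d poly_altdef[of f] sum.distrib sum_distrib_left)
    finally show "(\<Sum>i\<le>?N. coeff f i * (of_nat i * z ^ (i - 1) * fst w + of_nat (?N - i) * z ^ i * snd w))
      = (fst w - z * snd w) * poly (pderiv f) z" using assms by simp
  qed
  ultimately show ?thesis by simp
qed

text \<open>
  The complement of \<open>(z, 1)\<close> is spanned by \<open>(1, - cnj z)\<close>, which the derivative sends to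
  \<open>f'(z) (1 + |z|\<^sup>2)\<close>; so the inverse has norm \<open>1 / (|f'(z)| \<surd>(1 + |z|\<^sup>2))\<close>. The hypothesis is the squared
  bound, which avoids half-integer powers.
\<close>
lemma mu_norm_at_le:
  fixes f :: "complex poly"
  assumes root: "poly f z = 0" and simple: "poly (pderiv f) z \<noteq> 0" and deg: "2 \<le> degree f"
  assumes b: "0 \<le> b" and le: "real (degree f) * (bombieri_norm (degree f) (coeff f))\<^sup>2 * (1 + (cmod z)\<^sup>2) ^ (degree f - 2)
     \<le> b\<^sup>2 * (cmod (poly (pderiv f) z))\<^sup>2"
  shows "mu_norm_at f z \<le> ereal b"
proof -
  define N d D W q where "N = degree f" and "d = poly (pderiv f) z"
    and "D = (\<lambda>w :: complex \<times> complex. (fst w - z * snd w) * d)" and "W = hermitian_perp (z, 1)"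
    and "q = complex_of_real (1 + (cmod z)\<^sup>2)"
  have fr: "frechet_derivative (hom_poly N (coeff f)) (at (z, 1)) = D"
    using frechet_derivative_at[OF hom_poly_has_derivative[OF root]] by (simp add: N_def d_def D_def)
  have q: "q = 1 + z * cnj z" by (simp add: q_def complex_norm_square[symmetric])
  have q0: "0 < 1 + (cmod z)\<^sup>2" by (simp add: add_pos_nonneg)
  then have qn: "q \<noteq> 0" unfolding q_def of_real_eq_0_iff by linarith
  have dn: "d \<noteq> 0" using simple by (simp add: d_def)
  \<comment> \<open>The inverse of \<open>D\<close> on the complement of \<open>(z, 1)\<close>.\<close>
  define E where "E = (\<lambda>v :: complex. (v / (d * q), - cnj z * (v / (d * q))))"
  have EW: "E v \<in> W" for v
    by (simp add: E_def W_def hermitian_perp_def)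
  have DE: "D (E v) = v" for v
  proof -
    have "D (E v) = (v / (d * q)) * (q * d)"
      by (simp add: D_def E_def q algebra_simps del: times_divide_eq_left times_divide_eq_right)
    then show ?thesis using dn qn by simp
  qed
  have inj: "inj_on D W"
  proof (rule inj_onI)
    fix v w assume vw: "v \<in> W" "w \<in> W" "D v = D w"
    have s: "snd x = - cnj z * fst x" if "x \<in> W" for x
      using that by (simp add: W_def hermitian_perp_def add_eq_0_iff mult.commute)
    have "D x = fst x * q * d" if "x \<in> W" for x
      using s[OF that] by (simp add: D_def q algebra_simps)
    then have "fst v = fst w" using vw dn qn by auto
    then show "v = w" using s vw by (simp add: prod_eq_iff)
  qed
  have bij: "bij_betw D W UNIV"
    unfolding bij_betw_def using inj EW DE by (metis UNIV_eq_I image_eqI)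
  have inv: "inv_into W D = E"
  proof
    fix v show "inv_into W D v = E v" using inv_into_f_f[OF inj EW, of v] by (simp add: DE)
  qed
  define r where "r = sqrt (1 + (cmod z)\<^sup>2)"
  have r0: "0 < r" using q0 by (simp add: r_def)
  have r2: "r\<^sup>2 = 1 + (cmod z)\<^sup>2" using q0 by (simp add: r_def)
  have nr: "norm (z, 1 :: complex) = r" by (simp add: r_def norm_Pair add.commute)
  have on: "onorm E \<le> 1 / (cmod d * r)"
  proof (rule onorm_le)
    fix v
    have "norm (E v) = norm (v / (d * q)) * r"
    proof -
      define t where "t = v / (d * q)"
      have "(norm (E v))\<^sup>2 = (norm t)\<^sup>2 * r\<^sup>2"
        by (simp add: E_def t_def[symmetric] norm_Pair r2 norm_mult power_mult_distrib distrib_left mult.commute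
            del: times_divide_eq_left times_divide_eq_right)
      then have "(norm (E v))\<^sup>2 = (norm (v / (d * q)))\<^sup>2 * r\<^sup>2" by (simp add: t_def)
      then show ?thesis using r0 by (metis mult_nonneg_nonneg norm_ge_zero order_less_imp_le power2_eq_imp_eq power_mult_distrib)
    qed
    also have "cmod q = r\<^sup>2" using q0 by (simp add: q_def r2 norm_of_real del: of_real_add)
    then have "norm (v / (d * q)) * r = 1 / (cmod d * r) * norm v"
      using r0 by (simp add: norm_divide norm_mult power2_eq_square)
    finally show "norm (E v) \<le> 1 / (cmod d * r) * norm v" by simp
  qed
  define B where "B = bombieri_norm N (coeff f)"
  have B: "0 \<le> B" by (simp add: B_def bombieri_norm_def sum_nonneg)
  have "sqrt (real N) * onorm E * B * r ^ (N - 1) \<le> sqrt (real N) * (1 / (cmod d * r)) * B * r ^ (N - 1)"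
    using on B r0 by (intro mult_left_mono mult_right_mono) auto
  also have "\<dots> = sqrt (real N) * B * r ^ (N - 2) / cmod d"
  proof -
    have "N - 1 = Suc (N - 2)" using deg by (simp add: N_def)
    then show ?thesis using r0 by simp
  qed
  also have "\<dots> \<le> b"
  proof -
    have "(r ^ (N - 2))\<^sup>2 = (r\<^sup>2) ^ (N - 2)" by (metis power_mult mult.commute)
    then have "(sqrt (real N) * B * r ^ (N - 2))\<^sup>2 = real N * B\<^sup>2 * (1 + (cmod z)\<^sup>2) ^ (N - 2)"
      unfolding power_mult_distrib r2 by simp
    also have "\<dots> \<le> (b * cmod d)\<^sup>2" using le by (simp add: N_def B_def d_def power_mult_distrib)
    finally have "sqrt (real N) * B * r ^ (N - 2) \<le> b * cmod d"
      by (rule power2_le_imp_le) (simp add: b)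
    then show ?thesis using dn by (simp add: divide_le_eq)
  qed
  finally have "sqrt (real N) * onorm E * B * r ^ (N - 1) \<le> b" .
  then show ?thesis
    unfolding mu_norm_at_def mu_norm_hom_def N_def[symmetric] Let_def fr W_def[symmetric] nr inv B_def
    using bij by simp
qed

section \<open>Zeros and derivative of the polynomial\<close>

lemma rho_h_seq_sq:
  assumes "1 \<le> j" "j \<le> M"
  shows "(rho (h_seq (4 * M\<^sup>2) j))\<^sup>2 = radius_sq M j"
proof -
  have M: "0 < real M" using assms by simp
  have "(1 + h_seq (4 * M\<^sup>2) j) / (1 - h_seq (4 * M\<^sup>2) j) = radius_sq M j"
    using assms M by (simp add: h_seq_def radius_sq_def field_simps)
  then show ?thesis using radius_sq_pos[OF assms] by (simp add: rho_def)
qed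

lemma rho_h_seq_power:
  assumes "1 \<le> j" "j \<le> M"
  shows "rho (h_seq (4 * M\<^sup>2) j) ^ r_seq j = radius_sq M j ^ (2 * j)"
    "rho (h_seq (4 * M\<^sup>2) j) powi (- int (r_seq j)) = (1 / radius_sq M j) ^ (2 * j)"
proof -
  have "r_seq j = 2 * (2 * j)" by (simp add: r_seq_def)
  then show e: "rho (h_seq (4 * M\<^sup>2) j) ^ r_seq j = radius_sq M j ^ (2 * j)"
    by (metis power_mult rho_h_seq_sq[OF assms])
  show "rho (h_seq (4 * M\<^sup>2) j) powi (- int (r_seq j)) = (1 / radius_sq M j) ^ (2 * j)"
    by (simp only: power_int_minus power_int_of_nat e) (simp add: power_divide inverse_eq_divide)
qed

definition circle_poly :: "nat \<Rightarrow> real \<Rightarrow> complex poly" where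
  "circle_poly j c = monom 1 (4 * j) - [:complex_of_real (c ^ (2 * j)):]"

lemma poly_circle_poly: "poly (circle_poly j c) z = z ^ (4 * j) - complex_of_real (c ^ (2 * j))"
  by (simp add: circle_poly_def poly_monom)

lemma P_poly_eq:
  assumes "1 \<le> M"
  shows "P_poly M = (\<Prod>j=1..M. circle_poly j (radius_sq M j)) * (\<Prod>j=1..<M. circle_poly j (1 / radius_sq M j))"
proof -
  have i: "{1..M} = insert M {1..<M}" using assms by auto
  have "(\<Prod>j\<in>{1..<M}. (monom 1 (r_seq j) - [:complex_of_real (rho (h_seq (4 * M\<^sup>2) j) ^ r_seq j):]) *
        (monom 1 (r_seq j) - [:complex_of_real (rho (h_seq (4 * M\<^sup>2) j) powi (- int (r_seq j))):]))
     = (\<Prod>j=1..<M. circle_poly j (radius_sq M j) * circle_poly j (1 / radius_sq M j))"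
    by (rule prod.cong[OF refl], subst rho_h_seq_power, simp, simp, subst rho_h_seq_power)
      (auto simp: circle_poly_def r_seq_def)
  then show ?thesis unfolding P_poly_def Let_def i using assms
    by (simp add: prod.distrib circle_poly_def radius_sq_self r_seq_def one_pCons mult.assoc)
qed

lemma degree_circle_poly: "1 \<le> j \<Longrightarrow> degree (circle_poly j c) = 4 * j"
  unfolding circle_poly_def diff_conv_add_uminus
  by (subst degree_add_eq_left) (auto simp: degree_monom_eq)

lemma circle_poly_nonzero: "1 \<le> j \<Longrightarrow> circle_poly j c \<noteq> 0"
  using degree_circle_poly[of j c] by auto

lemma degree_P_poly:
  assumes "1 \<le> M"
  shows "degree (P_poly M) = 4 * M\<^sup>2"
proof -
  have "degree (P_poly M) = (\<Sum>j=1..M. 4 * j) + (\<Sum>j=1..<M. 4 * j)"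
    unfolding P_poly_eq[OF assms]
    by (simp add: degree_mult_eq degree_prod_eq_sum_degree circle_poly_nonzero degree_circle_poly)
  also have "\<dots> = 2 * ((\<Sum>j\<in>{0<..M}. 2 * j) + (\<Sum>j=1..<M. 2 * j))"
  proof -
    have "{0<..M} = {1..M}" by auto
    then show ?thesis by (simp add: sum_distrib_left)
  qed
  also have "\<dots> = 4 * M\<^sup>2" by (subst exponents_total) auto
  finally show ?thesis .
qed

text \<open>
  The pairs \<open>(w - c) (w - 1 / c)\<close> are self-reciprocal in \<open>w = z ^ (4 j)\<close>, and the equatorial factor
  changes its sign.
\<close>
lemma P_poly_inverse:
  assumes "1 \<le> M" "z \<noteq> 0"
  shows "poly (P_poly M) z = - (z ^ (4 * M\<^sup>2) * poly (P_poly M) (1 / z))"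
proof -
  have split: "(\<Prod>j=1..M. h j) = h M * (\<Prod>j=1..<M. h j)" for h :: "nat \<Rightarrow> complex"
  proof -
    have "{1..M} = insert M {1..<M}" using assms by auto
    then show ?thesis by simp
  qed
  have E: "4 * M\<^sup>2 = 4 * M + ((\<Sum>j=1..<M. 4 * j) + (\<Sum>j=1..<M. 4 * j))"
  proof -
    have "{0<..M} = insert M {1..<M}" using assms by auto
    then show ?thesis using exponents_total[of 0 M] by (simp add: sum_distrib_left[symmetric])
  qed
  have P: "poly (P_poly M) z = (z ^ (4 * M) - 1) * (\<Prod>j=1..<M. (z ^ (4 * j) - of_real (radius_sq M j ^ (2 * j))) * (z ^ (4 * j) - of_real ((1 / radius_sq M j) ^ (2 * j))))" for z
    unfolding P_poly_eq[OF assms(1)] poly_mult poly_prod poly_circle_poly split radius_sq_self[OF assms(1)] prod.distrib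
    by (simp only: power_one of_real_1 mult.assoc)
  have fac: "(z ^ (4 * j) - of_real (radius_sq M j ^ (2 * j))) * (z ^ (4 * j) - of_real ((1 / radius_sq M j) ^ (2 * j)))
      = (z ^ (4 * j) * z ^ (4 * j)) * (((1 / z) ^ (4 * j) - of_real (radius_sq M j ^ (2 * j))) * ((1 / z) ^ (4 * j) - of_real ((1 / radius_sq M j) ^ (2 * j))))"
    if j: "j \<in> {1..<M}" for j
  proof -
    define w c where "w = z ^ (4 * j)" and "c = complex_of_real (radius_sq M j ^ (2 * j))"
    have "0 < radius_sq M j" using j by (intro radius_sq_pos) auto
    then have c: "c \<noteq> 0" by (simp add: c_def)
    have w: "w \<noteq> 0" using assms by (simp add: w_def)
    have e: "(1 / z) ^ (4 * j) = 1 / w" "of_real ((1 / radius_sq M j) ^ (2 * j)) = 1 / c"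
      by (simp_all add: w_def c_def power_divide)
    show ?thesis unfolding e w_def[symmetric] c_def[symmetric] using w c by (simp add: field_simps)
  qed
  have "(\<Prod>j=1..<M. (z ^ (4 * j) - of_real (radius_sq M j ^ (2 * j))) * (z ^ (4 * j) - of_real ((1 / radius_sq M j) ^ (2 * j))))
     = (\<Prod>j=1..<M. (z ^ (4 * j) * z ^ (4 * j)) * (((1 / z) ^ (4 * j) - of_real (radius_sq M j ^ (2 * j))) * ((1 / z) ^ (4 * j) - of_real ((1 / radius_sq M j) ^ (2 * j)))))"
    by (rule prod.cong[OF refl fac])
  also have "\<dots> = (z ^ (\<Sum>j=1..<M. 4 * j) * z ^ (\<Sum>j=1..<M. 4 * j)) *
      (\<Prod>j=1..<M. ((1 / z) ^ (4 * j) - of_real (radius_sq M j ^ (2 * j))) * ((1 / z) ^ (4 * j) - of_real ((1 / radius_sq M j) ^ (2 * j))))"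
    unfolding prod.distrib power_sum ..
  finally show ?thesis unfolding P E power_add using assms by (simp add: power_divide field_simps)
qed

lemma P_poly_value_0:
  assumes "1 \<le> M"
  shows "poly (P_poly M) 0 \<noteq> 0"
proof -
  have "radius_sq M j \<noteq> 0" if "j \<in> {1..M}" for j using radius_sq_pos[of j M] that by auto
  then show ?thesis unfolding P_poly_eq[OF assms] poly_mult poly_prod poly_circle_poly
    by (auto simp: power_0_left)
qed

text \<open>
  Hence the condition numbers at \<open>z\<close> and \<open>1 / z\<close> agree, and only zeros in the northern hemisphere have
  to be studied.
\<close>
lemma pderiv_P_poly_inverse:
  assumes "1 \<le> M" "z \<noteq> 0" "poly (P_poly M) z = 0"
  shows "poly (P_poly M) (1 / z) = 0"
    "poly (pderiv (P_poly M)) z = z ^ (4 * M\<^sup>2 - 2) * poly (pderiv (P_poly M)) (1 / z)"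
proof -
  define N P where "N = 4 * M\<^sup>2" and "P = P_poly M"
  have "4 * 1\<^sup>2 \<le> N" unfolding N_def using assms by (intro mult_left_mono power_mono) auto
  then have N: "4 \<le> N" by simp
  show r: "poly (P_poly M) (1 / z) = 0" using P_poly_inverse[OF assms(1,2)] assms by simp
  have D: "((\<lambda>z. - (z ^ N * poly P (1 / z))) has_field_derivative
     - (of_nat N * z ^ (N - 1) * poly P (1 / z) + z ^ N * (poly (pderiv P) (1 / z) * (- (1 / z\<^sup>2))))) (at z)"
    using assms by (auto intro!: derivative_eq_intros DERIV_chain'[OF _ poly_DERIV] simp: power2_eq_square)
  have ev: "\<forall>\<^sub>F w in nhds z. - (w ^ N * poly P (1 / w)) = poly P w"
  proof (rule eventually_mono)
    show "\<forall>\<^sub>F w in nhds z. w \<in> - {0}" by (rule eventually_nhds_in_open) (use assms in auto)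
    show "- (w ^ N * poly P (1 / w)) = poly P w" if "w \<in> - {0}" for w
      using P_poly_inverse[OF assms(1), of w] that by (simp add: N_def P_def)
  qed
  have "poly (pderiv P) z = - (of_nat N * z ^ (N - 1) * poly P (1 / z) + z ^ N * (poly (pderiv P) (1 / z) * (- (1 / z\<^sup>2))))"
    by (rule DERIV_unique[OF poly_DERIV DERIV_cong_ev[OF refl ev refl, THEN iffD1, OF D]])
  also have "\<dots> = z ^ N / z\<^sup>2 * poly (pderiv P) (1 / z)" using r by (simp add: P_def)
  also have "z ^ N / z\<^sup>2 = z ^ (N - 2)" using assms N by (simp add: power_diff)
  finally show "poly (pderiv (P_poly M)) z = z ^ (4 * M\<^sup>2 - 2) * poly (pderiv (P_poly M)) (1 / z)"
    by (simp add: N_def P_def)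
qed

lemma zero_on_circle:
  assumes "1 \<le> M" "poly (P_poly M) z = 0" "1 \<le> cmod z"
  obtains k where "1 \<le> k" "k \<le> M" "(cmod z)\<^sup>2 = radius_sq M k" "z ^ (4 * k) = of_real (radius_sq M k ^ (2 * k))"
proof -
  have "(\<exists>j\<in>{1..M}. z ^ (4 * j) = of_real (radius_sq M j ^ (2 * j))) \<or> (\<exists>j\<in>{1..<M}. z ^ (4 * j) = of_real ((1 / radius_sq M j) ^ (2 * j)))"
    using assms(2) unfolding P_poly_eq[OF assms(1)] poly_mult poly_prod poly_circle_poly by auto
  then obtain k where k: "k \<in> {1..M}" "z ^ (4 * k) = of_real (radius_sq M k ^ (2 * k))"
  proof
    \<comment> \<open>The circles beyond the equator lie inside the unit disc.\<close>
    assume "\<exists>j\<in>{1..<M}. z ^ (4 * j) = of_real ((1 / radius_sq M j) ^ (2 * j))"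
    then obtain j where j: "j \<in> {1..<M}" "z ^ (4 * j) = of_real ((1 / radius_sq M j) ^ (2 * j))" by blast
    have s: "1 < radius_sq M j"
    proof -
      have "(real j)\<^sup>2 < (real M)\<^sup>2" using j by (intro power_strict_mono) auto
      then show ?thesis using j by (simp add: radius_sq_def divide_simps)
    qed
    have "cmod z ^ (4 * j) = (1 / radius_sq M j) ^ (2 * j)"
      using arg_cong[OF j(2), of cmod] s by (simp add: norm_power norm_of_real del: of_real_power of_real_divide)
    moreover have "1 \<le> cmod z ^ (4 * j)" using assms(3) by simp
    moreover have "(1 / radius_sq M j) ^ (2 * j) < 1" using s j by (intro power_less_one_iff[THEN iffD2]) auto
    ultimately have False by simp
    then show ?thesis ..
  qed (use that in blast)
  have sk: "0 < radius_sq M k" using k by (intro radius_sq_pos) auto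
  have "cmod z ^ (4 * k) = radius_sq M k ^ (2 * k)"
    using arg_cong[OF k(2), of cmod] sk by (simp add: norm_power norm_of_real del: of_real_power)
  then have "((cmod z)\<^sup>2) ^ (2 * k) = radius_sq M k ^ (2 * k)" by (simp add: power_mult[symmetric])
  then have "(cmod z)\<^sup>2 = radius_sq M k" by (rule power_eq_imp_eq_base) (use k sk in auto)
  then show ?thesis using that[of k] k by auto
qed

text \<open>
  By the reverse triangle inequality each factor is at least its value at the nearest configuration, in
  which a zero of circle \<open>j\<close> lies on the same ray as \<open>z\<close>; the deviations from the larger term are summable.
  The three groups (circles north of \<open>z\<close>, circles south of it up to the equator, circles beyond the equator)
  lose \<open>1 / 12\<close> each.
\<close>
lemma other_circles_lower:
  assumes k: "1 \<le> k" "k \<le> M" and z: "(cmod z)\<^sup>2 = radius_sq M k"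
  shows "(11 / 12) ^ 3 * ((\<Prod>j=1..<k. radius_sq M j ^ (2 * j)) * radius_sq M k ^ (2 * M\<^sup>2 - k * (k + 1)))
    \<le> cmod ((\<Prod>j\<in>{1..M} - {k}. poly (circle_poly j (radius_sq M j)) z) * (\<Prod>j=1..<M. poly (circle_poly j (1 / radius_sq M j)) z))"
proof -
  define c where "c = radius_sq M k"
  have c: "0 < c" "1 \<le> c" unfolding c_def using radius_sq_pos[OF k] radius_sq_ge_1[OF k] by auto
  have pw: "cmod (z ^ (4 * j)) = c ^ (2 * j)" for j
    unfolding norm_power c_def z[symmetric] by (simp add: power_mult[symmetric])
  have gap: "\<bar>c ^ (2 * j) - b ^ (2 * j)\<bar> \<le> cmod (poly (circle_poly j b) z)" if "0 < b" for j b
    using norm_triangle_ineq3[of "z ^ (4 * j)" "of_real (b ^ (2 * j))"] that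
    unfolding poly_circle_poly pw by (simp add: norm_of_real del: of_real_power)
  have inner: "11 / 12 * (\<Prod>j=1..<k. radius_sq M j ^ (2 * j)) \<le> (\<Prod>j=1..<k. cmod (poly (circle_poly j (radius_sq M j)) z))"
  proof (rule prod_perturbed_lower[where g = "\<lambda>j. k - j"])
    show "inj_on ((-) k) {1..<k}" by (auto simp: inj_on_def)
    fix j assume j: "j \<in> {1..<k}"
    then have sj: "0 < radius_sq M j" using k by (intro radius_sq_pos) auto
    then show "0 \<le> radius_sq M j ^ (2 * j)" by simp
    have "c ^ (2 * j) = (c / radius_sq M j) ^ (2 * j) * radius_sq M j ^ (2 * j)" using sj by (simp add: power_divide)
    also have "\<dots> \<le> 1 / (1 + real (k - j)) ^ 4 * radius_sq M j ^ (2 * j)"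
      unfolding c_def using radius_sq_ratio_power[of j k M] sj j k by (intro mult_right_mono) auto
    finally show "radius_sq M j ^ (2 * j) * (1 - 1 / (1 + real (k - j)) ^ 4) \<le> cmod (poly (circle_poly j (radius_sq M j)) z)"
      using gap[OF sj, of j] by (simp add: algebra_simps)
  qed auto
  have outer: "11 / 12 * (\<Prod>j\<in>{k<..M}. c ^ (2 * j)) \<le> (\<Prod>j\<in>{k<..M}. cmod (poly (circle_poly j (radius_sq M j)) z))"
  proof (rule prod_perturbed_lower[where g = "\<lambda>j. j - k"])
    show "inj_on (\<lambda>j. j - k) {k<..M}" by (auto simp: inj_on_def)
    fix j assume j: "j \<in> {k<..M}"
    then have sj: "0 < radius_sq M j" by (intro radius_sq_pos) auto
    show "0 \<le> c ^ (2 * j)" using c by simp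
    have "radius_sq M j ^ (2 * j) = (radius_sq M j / c) ^ (2 * j) * c ^ (2 * j)" using c by (simp add: power_divide)
    also have "\<dots> \<le> 1 / (1 + real (j - k)) ^ 4 * c ^ (2 * j)"
      unfolding c_def using radius_sq_ratio_power'[of k j M] c j k by (intro mult_right_mono) (auto simp: c_def)
    finally show "c ^ (2 * j) * (1 - 1 / (1 + real (j - k)) ^ 4) \<le> cmod (poly (circle_poly j (radius_sq M j)) z)"
      using gap[OF sj, of j] by (simp add: algebra_simps)
  qed auto
  have south: "11 / 12 * (\<Prod>j=1..<M. c ^ (2 * j)) \<le> (\<Prod>j=1..<M. cmod (poly (circle_poly j (1 / radius_sq M j)) z))"
  proof (rule prod_perturbed_lower[where g = "\<lambda>j. M - j"])
    show "inj_on ((-) M) {1..<M}" by (auto simp: inj_on_def)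
    fix j assume j: "j \<in> {1..<M}"
    then have sj: "0 < 1 / radius_sq M j" using radius_sq_pos[of j M] by auto
    show "0 \<le> c ^ (2 * j)" using c by simp
    have "(1 / radius_sq M j) ^ (2 * j) \<le> 1 / (1 + real (M - j)) ^ 4"
      using radius_sq_ratio_power[of j M M] j by (simp add: radius_sq_self)
    also have "\<dots> \<le> 1 / (1 + real (M - j)) ^ 4 * c ^ (2 * j)"
      using mult_left_mono[OF one_le_power[OF c(2), of "2 * j"], of "1 / (1 + real (M - j)) ^ 4"] by simp
    finally show "c ^ (2 * j) * (1 - 1 / (1 + real (M - j)) ^ 4) \<le> cmod (poly (circle_poly j (1 / radius_sq M j)) z)"
      using gap[OF sj, of j] by (simp add: algebra_simps)
  qed auto
  have i: "{1..M} - {k} = {1..<k} \<union> {k<..M}" using k by auto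
  have sn: "0 \<le> (\<Prod>j=1..<k. radius_sq M j ^ (2 * j))"
    using k by (intro prod_nonneg zero_le_power radius_sq_pos[THEN less_imp_le]) auto
  have "(11 / 12) ^ 3 * ((\<Prod>j=1..<k. radius_sq M j ^ (2 * j)) * c ^ (2 * M\<^sup>2 - k * (k + 1)))
     = (11 / 12 * (\<Prod>j=1..<k. radius_sq M j ^ (2 * j))) * (11 / 12 * (\<Prod>j\<in>{k<..M}. c ^ (2 * j))) * (11 / 12 * (\<Prod>j=1..<M. c ^ (2 * j)))"
    unfolding exponents_total[OF k(2), symmetric] power_add power_sum by (simp add: power_numeral_reduce)
  also have "\<dots> \<le> (\<Prod>j=1..<k. cmod (poly (circle_poly j (radius_sq M j)) z)) * (\<Prod>j\<in>{k<..M}. cmod (poly (circle_poly j (radius_sq M j)) z))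
      * (\<Prod>j=1..<M. cmod (poly (circle_poly j (1 / radius_sq M j)) z))"
    using inner outer south sn c by (intro mult_mono mult_nonneg_nonneg prod_nonneg) auto
  also have "\<dots> = cmod ((\<Prod>j\<in>{1..M} - {k}. poly (circle_poly j (radius_sq M j)) z) * (\<Prod>j=1..<M. poly (circle_poly j (1 / radius_sq M j)) z))"
  proof -
    have "{1..<k} \<inter> {k<..M} = {}" by auto
    then show ?thesis unfolding i by (simp add: norm_mult prod_norm prod.union_disjoint)
  qed
  finally show ?thesis by (simp add: c_def)
qed

text \<open>
  At a zero on circle \<open>k\<close> the derivative is \<open>4 k z ^ (4 k - 1)\<close> times the value of the remaining factors.
  The factor \<open>radius_sq M k\<close> on the right completes the power \<open>4 k - 1\<close> to \<open>4 k\<close>.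
\<close>
lemma pderiv_at_outer_zero:
  assumes M: "1 \<le> M" and root: "poly (P_poly M) z = 0" and k: "1 \<le> k" "k \<le> M"
    and z: "(cmod z)\<^sup>2 = radius_sq M k" "z ^ (4 * k) = of_real (radius_sq M k ^ (2 * k))"
  shows "9 * (real k)\<^sup>2 * (circle_value M k)\<^sup>2 * (1 + radius_sq M k) ^ (4 * M\<^sup>2)
    \<le> (cmod (poly (pderiv (P_poly M)) z))\<^sup>2 * radius_sq M k"
proof -
  define R where "R = (\<Prod>j\<in>{1..M} - {k}. circle_poly j (radius_sq M j)) * (\<Prod>j=1..<M. circle_poly j (1 / radius_sq M j))"
  have P: "P_poly M = circle_poly k (radius_sq M k) * R"
    unfolding P_poly_eq[OF M] R_def using k by (subst prod.remove[of "{1..M}" k]) (simp_all only: mult.assoc finite_atLeastAtMost atLeastAtMost_iff simp_thms)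
  have "poly (pderiv (P_poly M)) z = of_nat (4 * k) * z ^ (4 * k - 1) * poly R z"
    unfolding P pderiv_mult using z(2)
    by (simp add: poly_circle_poly) (simp add: circle_poly_def pderiv_diff pderiv_monom poly_monom pderiv_pCons)
  then have d: "cmod (poly (pderiv (P_poly M)) z) = real (4 * k) * cmod z ^ (4 * k - 1) * cmod (poly R z)"
    by (simp only: norm_mult norm_power norm_of_nat)
  define c u Q where "c = radius_sq M k" and "u = 2 * M\<^sup>2 - k * (k + 1)" and "Q = (\<Prod>j=1..<k. radius_sq M j ^ (2 * j))"
  have c: "0 < c" unfolding c_def using radius_sq_pos[OF k] .
  have Q: "0 \<le> Q" unfolding Q_def using k by (intro prod_nonneg zero_le_power radius_sq_pos[THEN less_imp_le]) auto
  have low: "(11 / 12) ^ 3 * (Q * c ^ u) \<le> cmod (poly R z)"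
    using other_circles_lower[OF k z(1)] unfolding R_def poly_mult poly_prod c_def u_def Q_def .
  have "k * (k + 1) \<le> M * (M + 1)" using k by (intro mult_le_mono) auto
  also have "\<dots> \<le> 2 * M\<^sup>2" using M by (simp add: power2_eq_square)
  finally have e: "2 * M\<^sup>2 - k * (k - 1) = u + 2 * k"
    unfolding u_def using k(1) by (cases k) (auto simp: algebra_simps)
  have cv: "circle_value M k * (1 + c) ^ (2 * M\<^sup>2) = c ^ (u + 2 * k) * Q"
    unfolding circle_value_def e c_def[symmetric] Q_def[symmetric] using c by simp
  have "(cmod z ^ (4 * k - 1))\<^sup>2 * c = c ^ (4 * k)"
  proof -
    have "(cmod z ^ (4 * k - 1))\<^sup>2 = c ^ (4 * k - 1)"
      unfolding c_def z(1)[symmetric] by (metis power_mult mult.commute)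
    moreover have "4 * k = Suc (4 * k - 1)" using k by simp
    ultimately show ?thesis by (metis power_Suc2)
  qed
  \<comment> \<open>The constant comes from \<open>(11 / 12) ^ 6 > 9 / 16\<close>.\<close>
  have "9 * (real k)\<^sup>2 * (circle_value M k)\<^sup>2 * (1 + c) ^ (4 * M\<^sup>2)
     = 9 * (real k)\<^sup>2 * (circle_value M k * (1 + c) ^ (2 * M\<^sup>2))\<^sup>2"
    by (simp add: power_mult_distrib power_mult[symmetric])
  also have "\<dots> = 9 / 16 * (real (4 * k))\<^sup>2 * c ^ (4 * k) * (Q * c ^ u)\<^sup>2"
    unfolding cv by (simp add: power_mult_distrib power_add power_mult[symmetric] mult_ac)
  also have "\<dots> \<le> ((11 / 12) ^ 3)\<^sup>2 * (real (4 * k))\<^sup>2 * c ^ (4 * k) * (Q * c ^ u)\<^sup>2"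
    using c by (intro mult_right_mono) (auto simp: power_numeral_reduce)
  also have "\<dots> = (real (4 * k))\<^sup>2 * c ^ (4 * k) * ((11 / 12) ^ 3 * (Q * c ^ u))\<^sup>2"
    by (simp only: power_mult_distrib mult_ac)
  also have "\<dots> \<le> (real (4 * k))\<^sup>2 * c ^ (4 * k) * (cmod (poly R z))\<^sup>2"
    using low c Q by (intro mult_left_mono power_mono) auto
  also have "\<dots> = (cmod (poly (pderiv (P_poly M)) z))\<^sup>2 * c"
    unfolding d \<open>(cmod z ^ (4 * k - 1))\<^sup>2 * c = c ^ (4 * k)\<close>[symmetric]
    by (simp only: power_mult_distrib mult_ac)
  finally show ?thesis by (simp add: c_def)
qed

section \<open>The upper bound for the condition number\<close>

lemma poly_mono_coeffs:
  fixes p q :: "real poly"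
  assumes "\<And>i. coeff p i \<le> coeff q i" "0 \<le> x"
  shows "poly p x \<le> poly q x"
proof -
  have "0 \<le> poly (q - p) x" unfolding poly_altdef using assms by (intro sum_nonneg mult_nonneg_nonneg) auto
  then show ?thesis by simp
qed

text \<open>
  Replacing all coefficients by their absolute values is submultiplicative, coefficient by coefficient.
\<close>
lemma poly_norms_mult_le:
  fixes p q :: "complex poly"
  assumes "0 \<le> x"
  shows "poly (map_poly cmod (p * q)) x \<le> poly (map_poly cmod p) x * poly (map_poly cmod q) x"
  unfolding poly_mult[symmetric]
  by (rule poly_mono_coeffs[OF _ assms])
    (auto simp: coeff_map_poly coeff_mult norm_mult intro!: order_trans[OF norm_sum])

lemma poly_norms_nonneg: "0 \<le> x \<Longrightarrow> 0 \<le> poly (map_poly cmod p) x"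
  unfolding poly_altdef by (intro sum_nonneg) (simp add: coeff_map_poly)

lemma poly_norms_prod_le:
  fixes f :: "nat \<Rightarrow> complex poly"
  assumes "0 \<le> x" "finite A"
  shows "poly (map_poly cmod (prod f A)) x \<le> (\<Prod>j\<in>A. poly (map_poly cmod (f j)) x)"
  using assms(2)
proof (induction A)
  case (insert j A)
  have "poly (map_poly cmod (f j * prod f A)) x \<le> poly (map_poly cmod (f j)) x * poly (map_poly cmod (prod f A)) x"
    by (rule poly_norms_mult_le[OF assms(1)])
  also have "\<dots> \<le> poly (map_poly cmod (f j)) x * (\<Prod>j\<in>A. poly (map_poly cmod (f j)) x)"
    using insert.IH assms(1) by (intro mult_left_mono poly_norms_nonneg)
  finally show ?case using insert.hyps by simp
qed (simp add: map_poly_1)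

lemma poly_norms_circle_poly:
  assumes "0 \<le> x" "0 < c"
  shows "poly (map_poly cmod (circle_poly j c)) x \<le> (x\<^sup>2) ^ (2 * j) + c ^ (2 * j)"
proof -
  have "poly (map_poly cmod (circle_poly j c)) x \<le> poly (monom 1 (4 * j) + [:c ^ (2 * j):]) x"
  proof (rule poly_mono_coeffs[OF _ assms(1)])
    fix i
    have "cmod (of_real (c ^ (2 * j))) = c ^ (2 * j)" using assms by (simp add: norm_of_real del: of_real_power)
    then show "coeff (map_poly cmod (circle_poly j c)) i \<le> coeff (monom 1 (4 * j) + [:c ^ (2 * j):]) i"
      using norm_triangle_ineq4[of "coeff (monom 1 (4 * j)) i :: complex" "coeff [:of_real (c ^ (2 * j)):] i"]
      by (auto simp: coeff_map_poly circle_poly_def coeff_pCons split: nat.splits)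
  qed
  then show ?thesis by (simp add: poly_monom power_mult[symmetric])
qed

lemma sum_norm_coeffs_le_dominant:
  assumes "1 \<le> M" "0 \<le> x"
  shows "(\<Sum>i\<le>4 * M\<^sup>2. cmod (coeff (P_poly M) i) * x ^ i) \<le> dominant M (x\<^sup>2)"
proof -
  have pos: "0 < radius_sq M j" if "j \<in> {1..M}" for j using radius_sq_pos[of j M] that by auto
  have "degree (map_poly cmod (P_poly M)) = 4 * M\<^sup>2"
    using degree_P_poly[OF assms(1)] by (simp add: degree_map_poly)
  then have "(\<Sum>i\<le>4 * M\<^sup>2. cmod (coeff (P_poly M) i) * x ^ i) = poly (map_poly cmod (P_poly M)) x"
    by (simp add: poly_altdef coeff_map_poly)
  also have "\<dots> \<le> poly (map_poly cmod (\<Prod>j=1..M. circle_poly j (radius_sq M j))) x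
      * poly (map_poly cmod (\<Prod>j=1..<M. circle_poly j (1 / radius_sq M j))) x"
    unfolding P_poly_eq[OF assms(1)] by (rule poly_norms_mult_le[OF assms(2)])
  also have "\<dots> \<le> (\<Prod>j=1..M. poly (map_poly cmod (circle_poly j (radius_sq M j))) x)
      * (\<Prod>j=1..<M. poly (map_poly cmod (circle_poly j (1 / radius_sq M j))) x)"
    using assms by (intro mult_mono poly_norms_prod_le prod_nonneg poly_norms_nonneg) auto
  also have "\<dots> \<le> dominant M (x\<^sup>2)"
    unfolding dominant_def
  proof (intro mult_mono prod_mono conjI poly_norms_nonneg prod_nonneg)
    show "poly (map_poly cmod (circle_poly j (radius_sq M j))) x \<le> (x\<^sup>2) ^ (2 * j) + radius_sq M j ^ (2 * j)" if "j \<in> {1..M}" for j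
      using poly_norms_circle_poly[OF assms(2) pos[OF that], of j] .
    show "poly (map_poly cmod (circle_poly j (1 / radius_sq M j))) x \<le> (x\<^sup>2) ^ (2 * j) + (1 / radius_sq M j) ^ (2 * j)" if "j \<in> {1..<M}" for j
      using poly_norms_circle_poly[OF assms(2), of "1 / radius_sq M j" j] pos[of j] that by auto
    show "0 \<le> (x\<^sup>2) ^ (2 * j) + radius_sq M j ^ (2 * j)" if "j \<in> {1..M}" for j
      using pos[OF that] by simp
  qed (use assms in auto)
  finally show ?thesis .
qed

text \<open>
  In terms of the squared radius \<open>c = (n - k\<^sup>2) / k\<^sup>2\<close> and \<open>1 + c = n / k\<^sup>2\<close>, the factors depending on
  \<open>k\<close> combine to \<open>(n - k\<^sup>2) / (circle_value M k)\<^sup>2\<close>, which is largest on the equator.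
\<close>
lemma derivative_bound_outer:
  assumes M: "1 \<le> M" and root: "poly (P_poly M) z = 0" and z: "1 \<le> cmod z"
    and B: "B \<le> 9 * b\<^sup>2 * (circle_value M M)\<^sup>2"
  shows "real (4 * M\<^sup>2) * B * (1 + (cmod z)\<^sup>2) ^ (4 * M\<^sup>2 - 2) \<le> b\<^sup>2 * (cmod (poly (pderiv (P_poly M)) z))\<^sup>2"
    "poly (pderiv (P_poly M)) z \<noteq> 0"
proof -
  obtain k where k: "1 \<le> k" "k \<le> M" and zk: "(cmod z)\<^sup>2 = radius_sq M k" "z ^ (4 * k) = of_real (radius_sq M k ^ (2 * k))"
    using zero_on_circle[OF M root z] .
  define N c K V D where "N = 4 * M\<^sup>2" and "c = radius_sq M k" and "K = circle_value M M"
    and "V = circle_value M k" and "D = cmod (poly (pderiv (P_poly M)) z)"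
  have V: "0 < V" unfolding V_def by (rule circle_value_pos[OF k])
  have c: "0 < c" unfolding c_def by (rule radius_sq_pos[OF k])
  have k0: "0 < (real k)\<^sup>2" using k by simp
  have N2: "2 \<le> N" unfolding N_def using M by (simp add: Suc_leI)
  have D: "9 * (real k)\<^sup>2 * V\<^sup>2 * (1 + c) ^ N \<le> D\<^sup>2 * c"
    using pderiv_at_outer_zero[OF M root k zk] by (simp add: V_def c_def N_def D_def)
  have "0 < 9 * (real k)\<^sup>2 * V\<^sup>2 * (1 + c) ^ N" using k0 V c by simp
  then have "0 < D\<^sup>2 * c" using D by linarith
  then show "poly (pderiv (P_poly M)) z \<noteq> 0" by (auto simp: D_def)
  have ck: "c * (real k)\<^sup>2 = 2 * (real M)\<^sup>2 - (real k)\<^sup>2" using k by (simp add: c_def radius_sq_def)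
  have c1: "(1 + c) * (real k)\<^sup>2 = 2 * (real M)\<^sup>2" using ck by (simp add: algebra_simps)
  have anti: "c * (real k)\<^sup>2 * K\<^sup>2 \<le> (real M)\<^sup>2 * V\<^sup>2"
    using circle_value_antimono[OF k] by (simp add: ck K_def V_def)
  have pw: "(1 + c) ^ N = (1 + c) ^ (N - 2) * (1 + c)\<^sup>2" using N2 by (metis power_add le_add_diff_inverse2)
  have "(real N * B * (1 + c) ^ (N - 2)) * (c * (real k)\<^sup>2) \<le> (real N * (9 * b\<^sup>2 * K\<^sup>2) * (1 + c) ^ (N - 2)) * (c * (real k)\<^sup>2)"
    using B c by (intro mult_right_mono mult_left_mono) (auto simp: K_def)
  also have "\<dots> = (9 * b\<^sup>2 * real N * (1 + c) ^ (N - 2)) * (c * (real k)\<^sup>2 * K\<^sup>2)" by (simp add: mult_ac)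
  also have "\<dots> \<le> (9 * b\<^sup>2 * real N * (1 + c) ^ (N - 2)) * ((real M)\<^sup>2 * V\<^sup>2)"
    using anti c by (intro mult_left_mono) auto
  also have "\<dots> = 9 * b\<^sup>2 * V\<^sup>2 * (1 + c) ^ (N - 2) * (2 * (real M)\<^sup>2)\<^sup>2"
    by (simp add: N_def power_mult_distrib power2_eq_square mult_ac)
  also have "\<dots> = b\<^sup>2 * (9 * (real k)\<^sup>2 * V\<^sup>2 * (1 + c) ^ N) * (real k)\<^sup>2"
    unfolding c1[symmetric] pw by (simp add: power_mult_distrib power2_eq_square mult_ac)
  also have "\<dots> \<le> b\<^sup>2 * (D\<^sup>2 * c) * (real k)\<^sup>2" using D by (intro mult_right_mono mult_left_mono) auto
  finally have "(real N * B * (1 + c) ^ (N - 2)) * (c * (real k)\<^sup>2) \<le> (b\<^sup>2 * D\<^sup>2) * (c * (real k)\<^sup>2)"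
    by (simp only: mult_ac)
  then show "real (4 * M\<^sup>2) * B * (1 + (cmod z)\<^sup>2) ^ (4 * M\<^sup>2 - 2) \<le> b\<^sup>2 * (cmod (poly (pderiv (P_poly M)) z))\<^sup>2"
    using c k0 unfolding zk N_def c_def D_def by (simp only: mult_le_cancel_right_pos mult_pos_pos)
qed

lemma mu_norm_at_zero_le:
  assumes M: "1 \<le> M" and root: "poly (P_poly M) z = 0" and b: "0 \<le> b"
    and B: "(bombieri_norm (4 * M\<^sup>2) (coeff (P_poly M)))\<^sup>2 \<le> 9 * b\<^sup>2 * (circle_value M M)\<^sup>2"
  shows "mu_norm_at (P_poly M) z \<le> ereal b"
proof -
  define N B2 where "N = 4 * M\<^sup>2" and "B2 = (bombieri_norm N (coeff (P_poly M)))\<^sup>2"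
  have deg: "degree (P_poly M) = N" by (simp add: N_def degree_P_poly[OF M])
  have N2: "2 \<le> N" unfolding N_def using M by (simp add: Suc_leI)
  have "real N * B2 * (1 + (cmod z)\<^sup>2) ^ (N - 2) \<le> b\<^sup>2 * (cmod (poly (pderiv (P_poly M)) z))\<^sup>2
      \<and> poly (pderiv (P_poly M)) z \<noteq> 0"
  proof (cases "1 \<le> cmod z")
    case True
    then show ?thesis using derivative_bound_outer[OF M root True B] by (simp add: N_def B2_def)
  next
    case False
    have z0: "z \<noteq> 0" using P_poly_value_0[OF M] root by auto
    have w: "1 \<le> cmod (1 / z)" using False z0 by (simp add: norm_divide divide_simps)
    define D where "D = cmod (poly (pderiv (P_poly M)) (1 / z))"
    note inv = pderiv_P_poly_inverse[OF M z0 root]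
    have nz: "poly (pderiv (P_poly M)) (1 / z) \<noteq> 0" using derivative_bound_outer(2)[OF M inv(1) w B] .
    have d: "cmod (poly (pderiv (P_poly M)) z) = cmod z ^ (N - 2) * D"
      by (simp add: inv(2) N_def D_def norm_mult norm_power)
    have "1 + (cmod z)\<^sup>2 = (cmod z)\<^sup>2 * (1 + (cmod (1 / z))\<^sup>2)"
      using z0 by (simp add: norm_divide power_divide field_simps)
    then have e: "(1 + (cmod z)\<^sup>2) ^ (N - 2) = (cmod z ^ (N - 2))\<^sup>2 * (1 + (cmod (1 / z))\<^sup>2) ^ (N - 2)"
      by (metis power_mult_distrib power_mult mult.commute)
    have "real N * B2 * (1 + (cmod z)\<^sup>2) ^ (N - 2) = (cmod z ^ (N - 2))\<^sup>2 * (real N * B2 * (1 + (cmod (1 / z))\<^sup>2) ^ (N - 2))"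
      unfolding e by (simp only: mult_ac)
    also have "\<dots> \<le> (cmod z ^ (N - 2))\<^sup>2 * (b\<^sup>2 * D\<^sup>2)"
      using derivative_bound_outer(1)[OF M inv(1) w B] unfolding N_def[symmetric] B2_def[symmetric] D_def[symmetric]
      by (intro mult_left_mono) auto
    also have "\<dots> = b\<^sup>2 * (cmod (poly (pderiv (P_poly M)) z))\<^sup>2"
      unfolding d by (simp only: power_mult_distrib mult_ac)
    finally show ?thesis using nz z0 inv(2) by simp
  qed
  then show ?thesis using mu_norm_at_le[of "P_poly M" z b] root b N2 unfolding deg B2_def by blast
qed

lemma bombieri_norm_P_poly_1: "(bombieri_norm 4 (coeff (P_poly 1)))\<^sup>2 = 2"
proof -
  have "{..4::nat} = {0, 1, 2, 3, 4}" by auto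
  moreover have "P_poly 1 = monom 1 4 - 1" by (simp add: P_poly_def r_seq_def)
  ultimately show ?thesis by (simp add: bombieri_norm_def)
qed

text \<open>
  For \<open>M \<ge> 2\<close> the constant is \<open>2 (17 / 8)\<^sup>2 exp (8 / 3) < 131\<close>, to be compared with \<open>9 N\<^sup>2 / (N + 1)\<close>,
  at least 135 from \<open>N = 16\<close> on, and with \<open>9 (19 / 2)\<^sup>2\<close>. The case \<open>M = 1\<close> is the polynomial
  \<open>z\<^sup>4 - 1\<close>, with squared norm 2.
\<close>
lemma bombieri_norm_P_poly_le:
  assumes "1 \<le> M"
  shows "(bombieri_norm (4 * M\<^sup>2) (coeff (P_poly M)))\<^sup>2
    \<le> 9 * (min (real (4 * M\<^sup>2)) (19 / 2 * sqrt (real (4 * M\<^sup>2) + 1)))\<^sup>2 * (circle_value M M)\<^sup>2"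
proof (cases "M = 1")
  case True
  have c: "circle_value M M = 1 / 4" by (simp add: True circle_value_def radius_sq_self power2_eq_square)
  have "1 \<le> sqrt (4 + 1 :: real)" by simp
  then have "4 \<le> 19 / 2 * sqrt (4 + 1 :: real)" by linarith
  then have m: "min (real (4 * M\<^sup>2)) (19 / 2 * sqrt (real (4 * M\<^sup>2) + 1)) = 4"
    by (simp add: True min_absorb1)
  have B: "(bombieri_norm (4 * M\<^sup>2) (coeff (P_poly M)))\<^sup>2 = 2"
    using bombieri_norm_P_poly_1 True by simp
  show ?thesis unfolding c m B by (simp add: power2_eq_square)
next
  case False
  define N b K where "N = real (4 * M\<^sup>2)" and "b = min N (19 / 2 * sqrt (N + 1))" and "K = circle_value M M"
  have M2: "2 \<le> M" using assms False by auto
  then have "2\<^sup>2 \<le> (real M)\<^sup>2" by (intro power_mono) auto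
  then have N: "16 \<le> N" by (simp add: N_def)
  have e: "exp (8 / 3) \<le> (29 / 2 :: real)"
  proof -
    have "exp (8 / 3) ^ 3 = exp (real 8)" by (subst exp_of_nat_mult[symmetric]) simp
    also have "\<dots> \<le> (272 / 100) ^ 8" by (rule exp_1_power_le)
    also have "\<dots> \<le> (29 / 2) ^ 3" by (simp add: field_simps)
    finally show ?thesis by (subst (asm) power_mono_iff) auto
  qed
  have "(N + 1) * 131 \<le> 9 * b\<^sup>2"
  proof (cases "N \<le> 19 / 2 * sqrt (N + 1)")
    case True
    have "131 * (N + 1) \<le> 9 * (16 * N)" using N by simp
    also have "\<dots> \<le> 9 * (N * N)" using N by (intro mult_left_mono mult_right_mono) auto
    finally show ?thesis using True by (simp add: b_def power2_eq_square mult_ac)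
  next
    case False
    then have "b\<^sup>2 = 361 / 4 * (N + 1)" using N by (simp add: b_def power_mult_distrib) (simp add: power2_eq_square)
    then show ?thesis using N by simp
  qed
  then have fin: "((N + 1) * 131) * K\<^sup>2 \<le> (9 * b\<^sup>2) * K\<^sup>2" by (intro mult_right_mono) auto
  have "(bombieri_norm (4 * M\<^sup>2) (coeff (P_poly M)))\<^sup>2 \<le> (N + 1) * (2 * ((17 / 8)\<^sup>2 * exp (8 / 3) * K\<^sup>2))"
    unfolding N_def K_def using sum_norm_coeffs_le_dominant[OF assms]
    by (intro bombieri_norm_le_dominant[OF M2]) auto
  also have "\<dots> = (N + 1) * (2 * (17 / 8)\<^sup>2 * exp (8 / 3)) * K\<^sup>2" by (simp only: mult_ac)
  also have "\<dots> \<le> (N + 1) * 131 * K\<^sup>2"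
    using e N by (intro mult_right_mono mult_left_mono) (auto simp: power2_eq_square)
  also note fin
  finally show ?thesis by (simp only: N_def b_def K_def)
qed

theorem theorem1p3:
  fixes M N :: nat
  assumes "M \<ge> 1" and "N = 4 * M\<^sup>2"
  shows "mu_norm (P_poly M) \<le> ereal (min (real N) (19 / 2 * sqrt (real N + 1)))"
proof -
  let ?Z = "{z. poly (P_poly M) z = 0}"
  have "0 < 4 * M\<^sup>2" using assms by simp
  then have deg: "0 < degree (P_poly M)" by (simp add: degree_P_poly[OF assms(1)])
  then have "P_poly M \<noteq> 0" by auto
  then have fin: "finite ?Z" by (rule poly_roots_finite)
  have "poly (P_poly M) 1 = 0"
    unfolding P_poly_eq[OF assms(1)] poly_mult poly_prod poly_circle_poly
    using assms(1) by (auto simp: radius_sq_self intro!: bexI[of _ M])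
  then have ne: "?Z \<noteq> {}" by blast
  have "mu_norm_at (P_poly M) z \<le> ereal (min (real N) (19 / 2 * sqrt (real N + 1)))" if "z \<in> ?Z" for z
    unfolding assms(2) by (rule mu_norm_at_zero_le[OF assms(1) _ _ bombieri_norm_P_poly_le[OF assms(1)]]) (use that in auto)
  then show ?thesis unfolding mu_norm_def using fin ne by (intro Max.boundedI) auto
qed

end
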